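(* Let $\nu\ge1$ and $p\ge 1$ be integers, and let $\omega\in\mathbb{R}^\nu$ have entries linearly independent over $\mathbb{Z}$. Let $\lambda:[0,\infty)\to(0,\infty)$ be a (not necessarily strictly) increasing function, bounded away from zero, satisfying $\lambda(q+r)\le\lambda(q)\lambda(r)$ for all $q,r\ge0$. Then, for either choice of sign, the nonlinear Schrödinger equation $$\partial_t u-i\partial_x^2u\pm i|u|^{2p}u=0,\qquad u(0,x)=u_0(x)$$ is unconditionally locally well-posed in $A^{\omega,\lambda}$ (forward and backward in time). That is: for every $u_0\in A^{\omega,\lambda}$ there exist an open ball $B\subseteq A^{\omega,\lambda}$ containing $u_0$ and a $T>0$ such that for every $\tilde u_0\in B$ there exists a unique solution $u\in C([-T,T],A^{\omega,\lambda})$ with initial data $\tilde u_0$, and the data-to-solution map $B\to C([-T,T],A^{\omega,\lambda})$ is Lipschitz continuous.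
   Context: $|\cdot|$ on $\mathbb{Z}^\nu$ is the Euclidean norm. $A^{\omega,\lambda}$ is the space of functions $u:\mathbb{R}\to\mathbb{C}$ of the form $u(x)=\sum_{n\in\mathbb{Z}^\nu}\widehat u(n)e^{i\langle\omega,n\rangle x}$ with finite norm $\|u\|_{A^{\omega,\lambda}}=\sum_{n\in\mathbb{Z}^\nu}|\widehat u(n)|\lambda(|n|)$; the coefficients are uniquely determined by $u$. $C([-T,T],A^{\omega,\lambda})$ is the space of continuous functions $[-T,T]\to A^{\omega,\lambda}$ with norm $\sup_{t\in[-T,T]}\|u(t,\cdot)\|_{A^{\omega,\lambda}}$. The propagator $e^{it\partial_x^2}$ acts by $\widehat{e^{it\partial_x^2}v}(n)=e^{-it\langle\omega,n\rangle^2}\widehat v(n)$. A function $u\in C([-T,T],A^{\omega,\lambda})$ is called a solution with initial data $u_0$ if Duhamel's formula $$u(t)=e^{it\partial_x^2}u_0\mp i\int_0^te^{i(t-\tau)\partial_x^2}\big[(|u|^{2p}u)(\tau)\big]\,d\tau$$ holds pointwise in space and time, for all $(t,x)\in[-T,T]\times\mathbb{R}$ (the sign $\mp$ corresponding to $\pm$ in the equation). *)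

theory Defs
  imports "HOL-Analysis.Analysis"
begin

definition lattice_vec :: "int ^ 'n \<Rightarrow> real ^ 'n::finite" where
  "lattice_vec n = (\<chi> i. real_of_int (n $ i))"

definition entries_int_independent :: "real ^ 'n::finite \<Rightarrow> bool" where
  "entries_int_independent \<omega> \<longleftrightarrow>
     (\<forall>k :: int ^ 'n. (\<Sum>i\<in>UNIV. real_of_int (k $ i) * \<omega> $ i) = 0 \<longrightarrow> k = 0)"

(* No separate absolute convergence requirement is needed: has_sum over an index set is
   unconditional convergence, which for complex series is absolute convergence. *)
definition has_fourier_coeffs ::
    "real ^ 'n::finite \<Rightarrow> (real \<Rightarrow> complex) \<Rightarrow> (int ^ 'n \<Rightarrow> complex) \<Rightarrow> bool" where
  "has_fourier_coeffs \<omega> u c \<longleftrightarrow>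
     (\<forall>x. ((\<lambda>n. c n * cis ((\<omega> \<bullet> lattice_vec n) * x)) has_sum u x) UNIV)"

(* The coefficients are unique when the entries of \<omega> are linearly independent over the integers. *)
definition fourier_coeff ::
    "real ^ 'n::finite \<Rightarrow> (real \<Rightarrow> complex) \<Rightarrow> int ^ 'n \<Rightarrow> complex" where
  "fourier_coeff \<omega> u = (THE c. has_fourier_coeffs \<omega> u c)"

(* wt is the weight, a function used only on {0..}; the sum in A_norm is over the integer lattice. *)
definition A_space ::
    "real ^ 'n::finite \<Rightarrow> (real \<Rightarrow> real) \<Rightarrow> (real \<Rightarrow> complex) set" where
  "A_space \<omega> wt = {u. \<exists>c. has_fourier_coeffs \<omega> u c \<and>
     (\<lambda>n. cmod (c n) * wt (norm (lattice_vec n))) summable_on UNIV}"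

definition A_norm ::
    "real ^ 'n::finite \<Rightarrow> (real \<Rightarrow> real) \<Rightarrow> (real \<Rightarrow> complex) \<Rightarrow> real" where
  "A_norm \<omega> wt u = (\<Sum>\<^sub>\<infinity>n. cmod (fourier_coeff \<omega> u n) * wt (norm (lattice_vec n)))"

definition A_ball ::
    "real ^ 'n::finite \<Rightarrow> (real \<Rightarrow> real) \<Rightarrow> (real \<Rightarrow> complex) \<Rightarrow> real \<Rightarrow> (real \<Rightarrow> complex) set" where
  "A_ball \<omega> wt a r = {v \<in> A_space \<omega> wt. A_norm \<omega> wt (v - a) < r}"

(* Elements are the maps t \<mapsto> u t with u t a function of x. They are extensional, that is
   undefined for t outside {-T..T}, so that equality in HOL is equality on [-T,T]. *)
definition CA_space ::
    "real ^ 'n::finite \<Rightarrow> (real \<Rightarrow> real) \<Rightarrow> real \<Rightarrow> (real \<Rightarrow> real \<Rightarrow> complex) set" where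
  "CA_space \<omega> wt T = {u \<in> {-T..T} \<rightarrow>\<^sub>E A_space \<omega> wt.
     \<forall>t\<in>{-T..T}. ((\<lambda>s. A_norm \<omega> wt (u s - u t)) \<longlongrightarrow> 0) (at t within {-T..T})}"

definition CA_norm ::
    "real ^ 'n::finite \<Rightarrow> (real \<Rightarrow> real) \<Rightarrow> real \<Rightarrow> (real \<Rightarrow> real \<Rightarrow> complex) \<Rightarrow> real" where
  "CA_norm \<omega> wt T u = (SUP t\<in>{-T..T}. A_norm \<omega> wt (u t))"

definition propagator ::
    "real ^ 'n::finite \<Rightarrow> real \<Rightarrow> (real \<Rightarrow> complex) \<Rightarrow> real \<Rightarrow> complex" where
  "propagator \<omega> t v x =
     (\<Sum>\<^sub>\<infinity>n. cis (- t * (\<omega> \<bullet> lattice_vec n)\<^sup>2) * fourier_coeff \<omega> v n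
            * cis ((\<omega> \<bullet> lattice_vec n) * x))"

definition nonlinearity :: "nat \<Rightarrow> (real \<Rightarrow> complex) \<Rightarrow> real \<Rightarrow> complex" where
  "nonlinearity p v x = complex_of_real (cmod (v x) ^ (2 * p)) * v x"

(* \<sigma> = 1 and \<sigma> = -1 are the upper and the lower sign in
   u_t - i u_xx \<plusminus> i |u|^(2p) u = 0.
   The interval integral is oriented, so t < 0 is covered. *)
definition NLS_solution ::
    "real ^ 'n::finite \<Rightarrow> (real \<Rightarrow> real) \<Rightarrow> nat \<Rightarrow> real \<Rightarrow> real \<Rightarrow> (real \<Rightarrow> complex) \<Rightarrow>
     (real \<Rightarrow> real \<Rightarrow> complex) \<Rightarrow> bool" where
  "NLS_solution \<omega> wt p \<sigma> T u0 u \<longleftrightarrow>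
     u \<in> CA_space \<omega> wt T \<and>
     (\<forall>t\<in>{-T..T}. \<forall>x. u t x = propagator \<omega> t u0 x
        - complex_of_real \<sigma> * \<i>
          * (LBINT \<tau>=ereal 0..ereal t. propagator \<omega> (t - \<tau>) (nonlinearity p (u \<tau>)) x))"

definition data_to_solution ::
    "real ^ 'n::finite \<Rightarrow> (real \<Rightarrow> real) \<Rightarrow> nat \<Rightarrow> real \<Rightarrow> real \<Rightarrow> (real \<Rightarrow> complex) \<Rightarrow>
     real \<Rightarrow> real \<Rightarrow> complex" where
  "data_to_solution \<omega> wt p \<sigma> T u0 = (THE u. NLS_solution \<omega> wt p \<sigma> T u0 u)"

end

theory Submission
  imports Defs
begin

text \<open>
Almost periodic functions with frequency vector \<open>\<omega>\<close> are identified with their weighted Fourier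
coefficients \<open>wt(|n|) c(n)\<close>, so that the function space becomes the
space of absolutely summable families over the lattice. There the propagator is a strongly continuous
family of linear contractions, and submultiplicativity of the weight makes pointwise multiplication a
bounded bilinear map, so the nonlinearity is Lipschitz on bounded sets. Point evaluation is bounded linear,
so Duhamel's formula at every point is the same as Duhamel's formula for Banach-valued
integrals. A contraction argument in a large ball gives existence and Lipschitz dependence; uniqueness without
a size restriction follows by iterating the Duhamel estimate, which bounds the difference of two
solutions by \<open>2 R (K |t|)\<^sup>k / k!\<close> for every \<open>k\<close>.
\<close>

section \<open>Absolutely summable families\<close>

text \<open>The frequencies are unbounded, so the propagators are continuous in time strongly but
  not in operator norm. The abstract part is therefore built on joint continuity in time and vector,
  together with contractivity. Duhamel's formula contains no derivative of the solution, and the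
  even power \<open>2 * p\<close> makes the nonlinearity a polynomial in the function and its
  conjugate; the algebra property of the space then controls it completely. Linear independence of
  the frequencies enters through uniqueness of coefficients, which gives a meaning to the norm and
  the propagator, both defined through \<open>fourier_coeff\<close>. That uniqueness is obtained
  without mean values of almost periodic functions: combining finitely many modulated translates of
  the zero function isolates one mode up to an arbitrarily small tail.\<close>

typedef 'a l1 = "{f :: 'a \<Rightarrow> complex. (\<lambda>i. norm (f i)) summable_on UNIV}"
  morphisms coord Abs_l1
  by (rule exI[of _ "\<lambda>_. 0"]) simp

setup_lifting type_definition_l1

lemma coord_abs_summable: "(\<lambda>i. norm (coord x i)) summable_on UNIV"
  using coord by auto

lemma l1_eqI: "(\<And>i. coord x i = coord y i) \<Longrightarrow> x = y"
  by (auto simp: coord_inject[symmetric])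

lemma coord_Abs_l1: "(\<lambda>i. norm (f i)) summable_on UNIV \<Longrightarrow> coord (Abs_l1 f) = f"
  by (simp add: Abs_l1_inverse)

instantiation l1 :: (type) real_normed_vector
begin

lift_definition zero_l1 :: "'a l1" is "\<lambda>_. 0" by simp

lift_definition plus_l1 :: "'a l1 \<Rightarrow> 'a l1 \<Rightarrow> 'a l1" is "\<lambda>f g i. f i + g i"
proof -
  fix f g :: "'a \<Rightarrow> complex"
  assume "(\<lambda>i. norm (f i)) summable_on UNIV" "(\<lambda>i. norm (g i)) summable_on UNIV"
  then have "(\<lambda>i. norm (f i) + norm (g i)) summable_on UNIV"
    by (rule summable_on_add)
  then show "(\<lambda>i. norm (f i + g i)) summable_on UNIV"
    by (rule summable_on_comparison_test) (simp_all add: norm_triangle_ineq)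
qed

lift_definition uminus_l1 :: "'a l1 \<Rightarrow> 'a l1" is "\<lambda>f i. - f i" by simp

definition minus_l1 :: "'a l1 \<Rightarrow> 'a l1 \<Rightarrow> 'a l1" where "minus_l1 x y = x + - y"

lift_definition scaleR_l1 :: "real \<Rightarrow> 'a l1 \<Rightarrow> 'a l1" is "\<lambda>r f i. r *\<^sub>R f i"
  by (simp add: summable_on_cmult_right)

lift_definition norm_l1 :: "'a l1 \<Rightarrow> real" is "\<lambda>f. \<Sum>\<^sub>\<infinity>i. norm (f i)" .

definition dist_l1 :: "'a l1 \<Rightarrow> 'a l1 \<Rightarrow> real" where "dist_l1 x y = norm (x - y)"
definition sgn_l1 :: "'a l1 \<Rightarrow> 'a l1" where "sgn_l1 x = inverse (norm x) *\<^sub>R x"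
definition uniformity_l1 :: "('a l1 \<times> 'a l1) filter"
  where "uniformity_l1 = (INF e\<in>{0<..}. principal {(x, y). dist x y < e})"
definition open_l1 :: "'a l1 set \<Rightarrow> bool"
  where "open_l1 U \<longleftrightarrow> (\<forall>x\<in>U. eventually (\<lambda>(x', y). x' = x \<longrightarrow> y \<in> U) uniformity)"

instance
proof
  fix x y :: "'a l1" and r s :: real
  show "x - y = x + - y" by (rule minus_l1_def)
  show "norm (r *\<^sub>R x) = \<bar>r\<bar> * norm x"
    by transfer (simp add: infsum_cmult_right)
  show "norm (x + y) \<le> norm x + norm y"
  proof transfer
    fix f g :: "'a \<Rightarrow> complex"
    assume fg: "(\<lambda>i. norm (f i)) summable_on UNIV" "(\<lambda>i. norm (g i)) summable_on UNIV"
    have s: "(\<lambda>i. norm (f i) + norm (g i)) summable_on UNIV"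
      using fg by (rule summable_on_add)
    have "(\<lambda>i. norm (f i + g i)) summable_on UNIV"
      using s by (rule summable_on_comparison_test) (simp_all add: norm_triangle_ineq)
    then have "(\<Sum>\<^sub>\<infinity>i. norm (f i + g i)) \<le> (\<Sum>\<^sub>\<infinity>i. norm (f i) + norm (g i))"
      using s by (rule infsum_mono) (simp add: norm_triangle_ineq)
    then show "(\<Sum>\<^sub>\<infinity>i. norm (f i + g i)) \<le> (\<Sum>\<^sub>\<infinity>i. norm (f i)) + (\<Sum>\<^sub>\<infinity>i. norm (g i))"
      by (simp add: infsum_add fg)
  qed
  show "norm x = 0 \<longleftrightarrow> x = 0"
  proof transfer
    fix f :: "'a \<Rightarrow> complex"
    assume "(\<lambda>i. norm (f i)) summable_on UNIV"
    then have "f i = 0" if "(\<Sum>\<^sub>\<infinity>i. norm (f i)) = 0" for i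
      using nonneg_infsum_le_0D[of "\<lambda>i. norm (f i)" UNIV i] that by simp
    then show "(\<Sum>\<^sub>\<infinity>i. norm (f i)) = 0 \<longleftrightarrow> f = (\<lambda>_. 0)"
      by (intro iffI ext) (blast, simp)
  qed
  show "x + y + z = x + (y + z)" for z by transfer (simp add: add.assoc)
  show "x + y = y + x" by transfer (simp add: add.commute)
  show "0 + x = x" by transfer simp
  show "- x + x = 0" by transfer simp
  show "r *\<^sub>R (x + y) = r *\<^sub>R x + r *\<^sub>R y" by transfer (simp add: scaleR_add_right)
  show "(r + s) *\<^sub>R x = r *\<^sub>R x + s *\<^sub>R x" by transfer (simp add: scaleR_add_left)
  show "r *\<^sub>R s *\<^sub>R x = (r * s) *\<^sub>R x" by transfer simp
  show "1 *\<^sub>R x = x" by transfer simp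
qed (simp_all add: dist_l1_def sgn_l1_def uniformity_l1_def open_l1_def)

end

lemma coord_0 [simp]: "coord 0 i = 0"
  by transfer simp

lemma coord_add [simp]: "coord (x + y) i = coord x i + coord y i"
  by transfer simp

lemma coord_uminus [simp]: "coord (- x) i = - coord x i"
  by transfer simp

lemma coord_diff [simp]: "coord (x - y) i = coord x i - coord y i"
  by (simp only: minus_l1_def coord_add coord_uminus diff_conv_add_uminus)

lemma coord_scaleR [simp]: "coord (r *\<^sub>R x) i = r *\<^sub>R coord x i"
  by transfer simp

lemma norm_l1_eq: "norm x = (\<Sum>\<^sub>\<infinity>i. norm (coord x i))"
  by transfer simp

lemma sum_coord_le_norm: "finite F \<Longrightarrow> (\<Sum>i\<in>F. norm (coord x i)) \<le> norm x"
  unfolding norm_l1_eq by (rule finite_sum_le_infsum) (auto simp: coord_abs_summable)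

lemma norm_coord_le: "norm (coord x i) \<le> norm x"
  using sum_coord_le_norm[of "{i}" x] by simp

text \<open>For a family that arises as a limit or as a convolution, bounds on finite partial sums
  are what is at hand; this turns them into an element of \<open>l1\<close> with the same norm
  bound.\<close>

lemma l1_of_bounded_sums:
  assumes "\<And>F. finite F \<Longrightarrow> (\<Sum>i\<in>F. norm (f i)) \<le> B"
  obtains x where "coord x = f" "norm x \<le> B"
proof
  have s: "(\<lambda>i. norm (f i)) summable_on UNIV"
    by (rule nonneg_bdd_above_summable_on) (auto intro!: bdd_aboveI2 assms)
  then show c: "coord (Abs_l1 f) = f"
    by (rule coord_Abs_l1)
  show "norm (Abs_l1 f) \<le> B"
    unfolding norm_l1_eq c using s by (rule infsum_le_finite_sums) (use assms in auto)
qed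

section \<open>Completeness of the space of summable families\<close>

instance l1 :: (type) banach
proof
  fix X :: "nat \<Rightarrow> 'a l1"
  assume X: "Cauchy X"
  have "Cauchy (\<lambda>n. coord (X n) i)" for i
  proof (rule metric_CauchyI)
    fix e :: real
    assume "e > 0"
    then obtain N where "\<forall>m\<ge>N. \<forall>n\<ge>N. dist (X m) (X n) < e"
      using X by (meson metric_CauchyD)
    then show "\<exists>N. \<forall>m\<ge>N. \<forall>n\<ge>N. dist (coord (X m) i) (coord (X n) i) < e"
      using norm_coord_le[of "X _ - X _" i] by (metis coord_diff dist_norm order_le_less_trans)
  qed
  then have "\<exists>l. (\<lambda>n. coord (X n) i) \<longlonglongrightarrow> l" for i
    by (simp add: Cauchy_convergent_iff convergent_def)
  then obtain f where f: "\<And>i. (\<lambda>n. coord (X n) i) \<longlonglongrightarrow> f i"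
    by metis
  \<comment> \<open>The pointwise limit \<open>f\<close> is not yet known to be summable, so the
    limit in \<open>m\<close> is taken in finite partial sums.\<close>
  have tail: "(\<Sum>i\<in>F. norm (coord (X n) i - f i)) \<le> e"
    if "\<forall>m\<ge>N. \<forall>n\<ge>N. dist (X m) (X n) < e" "n \<ge> N" "finite F" for e N n F
  proof (rule LIMSEQ_le_const2)
    show "(\<lambda>m. \<Sum>i\<in>F. norm (coord (X n) i - coord (X m) i)) \<longlonglongrightarrow> (\<Sum>i\<in>F. norm (coord (X n) i - f i))"
      by (intro tendsto_intros f)
    have "(\<Sum>i\<in>F. norm (coord (X n) i - coord (X m) i)) \<le> e" if "m \<ge> N" for m
    proof -
      have "norm (X n - X m) < e"
        using that \<open>n \<ge> N\<close> \<open>\<forall>m\<ge>N. \<forall>n\<ge>N. dist (X m) (X n) < e\<close> by (simp add: dist_norm)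
      then show ?thesis
        using sum_coord_le_norm[OF \<open>finite F\<close>, of "X n - X m"] by simp
    qed
    then show "\<exists>N. \<forall>m\<ge>N. (\<Sum>i\<in>F. norm (coord (X n) i - coord (X m) i)) \<le> e"
      by blast
  qed
  obtain N1 where N1: "\<forall>m\<ge>N1. \<forall>n\<ge>N1. dist (X m) (X n) < 1"
    using X by (meson metric_CauchyD zero_less_one)
  \<comment> \<open>The bound is available for the difference to one late term, here 1 by the choice
    of \<open>N1\<close>; the limit is recovered from that difference by subtraction.\<close>
  obtain d where d: "coord d = (\<lambda>i. coord (X N1) i - f i)"
    using l1_of_bounded_sums[of "\<lambda>i. coord (X N1) i - f i" 1] tail[OF N1] by blast
  define L where "L = X N1 - d"
  have L: "coord L i = f i" for i
    by (simp add: L_def d)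
  have "X \<longlonglongrightarrow> L"
  proof (rule metric_LIMSEQ_I)
    fix e :: real
    assume "e > 0"
    then obtain N where N: "\<forall>m\<ge>N. \<forall>n\<ge>N. dist (X m) (X n) < e/2"
      using X by (meson half_gt_zero metric_CauchyD)
    have "norm (X n - L) \<le> e/2" if n: "n \<ge> N" for n
    proof -
      obtain y where "coord y = (\<lambda>i. coord (X n) i - f i)" "norm y \<le> e/2"
        using l1_of_bounded_sums[of "\<lambda>i. coord (X n) i - f i" "e/2"] tail[OF N n] by blast
      moreover from this have "y = X n - L"
        by (intro l1_eqI) (simp add: L)
      ultimately show ?thesis by simp
    qed
    then show "\<exists>N. \<forall>n\<ge>N. dist (X n) L < e"
      using \<open>e > 0\<close> by (force simp: dist_norm)
  qed
  then show "convergent X"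
    by (rule convergentI)
qed

section \<open>Semilinear evolution equations in a Banach space\<close>

locale semilinear =
  fixes S :: "real \<Rightarrow> 'a::banach \<Rightarrow> 'a" and G :: "'a \<Rightarrow> 'a"
  assumes S_diff: "S t (x - y) = S t x - S t y"
    and S_norm: "norm (S t x) \<le> norm x"
    and S_cont: "continuous_on UNIV (\<lambda>(t, x). S t x)"
    and G_lip: "\<exists>K. \<forall>x y. norm x \<le> R \<longrightarrow> norm y \<le> R \<longrightarrow> norm (G x - G y) \<le> K * norm (x - y)"
    and G_0: "G 0 = 0"
begin

\<comment> \<open>The substitution of t s for the time variable makes the integral oriented without a case distinction on the sign of t.\<close>
definition duhamel :: "(real \<Rightarrow> 'a) \<Rightarrow> real \<Rightarrow> 'a" where
  "duhamel f t = t *\<^sub>R integral {0..1} (\<lambda>s. S (t - t * s) (G (f (t * s))))"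

definition mild_sol :: "real \<Rightarrow> 'a \<Rightarrow> (real \<Rightarrow> 'a) \<Rightarrow> bool" where
  "mild_sol T z f \<longleftrightarrow> continuous_on {-T..T} f \<and> (\<forall>t\<in>{-T..T}. f t = S t z + duhamel f t)"

section \<open>Continuity and difference estimates for the Duhamel operator\<close>

lemma G_lip_pos:
  obtains K where "K > 0" "\<And>x y. norm x \<le> R \<Longrightarrow> norm y \<le> R \<Longrightarrow> norm (G x - G y) \<le> K * norm (x - y)"
proof -
  obtain K where K: "norm (G x - G y) \<le> K * norm (x - y)" if "norm x \<le> R" "norm y \<le> R" for x y
    using G_lip[of R] by blast
  have "K * norm (x - y) \<le> (\<bar>K\<bar> + 1) * norm (x - y)" for x y
    by (intro mult_right_mono) auto
  then show ?thesis
    using K by (intro that[of "\<bar>K\<bar> + 1"]) (auto intro: order_trans[OF K])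
qed

lemma G_cont: "continuous_on A G"
proof -
  have "isCont G x" for x
  proof -
    obtain K where K: "norm (G u - G y) \<le> K * norm (u - y)"
      if "norm u \<le> norm x + 1" "norm y \<le> norm x + 1" for u y
      using G_lip[of "norm x + 1"] by blast
    have "eventually (\<lambda>y. norm (G y - G x) \<le> K * norm (y - x)) (at x)"
    proof -
      have "eventually (\<lambda>y. dist y x < 1) (at x)"
        by (metis eventually_at zero_less_one)
      then show ?thesis
      proof eventually_elim
        case (elim y)
        then have "norm y \<le> norm x + 1"
          using norm_triangle_ineq2[of y x] by (simp add: dist_norm)
        then show ?case by (intro K) auto
      qed
    qed
    moreover have "((\<lambda>y. K * norm (y - x)) \<longlongrightarrow> 0) (at x)"
      by (auto intro!: tendsto_eq_intros)
    ultimately have "((\<lambda>y. G y - G x) \<longlongrightarrow> 0) (at x)"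
      by (rule Lim_null_comparison)
    then show ?thesis
      unfolding isCont_def by (rule Lim_null[THEN iffD2])
  qed
  then show ?thesis
    by (simp add: continuous_at_imp_continuous_on)
qed

text \<open>General \<open>c\<close> and \<open>d\<close> let one lemma cover the integrand in the
  scaled time alone, jointly in both times, and in the unscaled time.\<close>

lemma integrand_continuous:
  assumes "continuous_on A c" "continuous_on A d" "continuous_on (d ` A) f"
  shows "continuous_on A (\<lambda>x. S (c x) (G (f (d x))))"
proof -
  have "continuous_on A (\<lambda>x. G (f (d x)))"
    using continuous_on_compose[OF assms(2,3)]
      continuous_on_compose[OF _ G_cont, of A "f \<circ> d"] by (simp add: o_def)
  then show ?thesis
    using continuous_on_compose2[OF S_cont continuous_on_Pair[OF assms(1)]] by simp
qed

lemma scaled_mem: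
  fixes t s T :: real
  assumes "t \<in> {-T..T}" "s \<in> {0..1}"
  shows "t * s \<in> {-T..T}"
proof -
  have "\<bar>t * s\<bar> \<le> \<bar>t\<bar>"
    using assms by (auto simp: abs_mult intro: mult_left_le)
  then show ?thesis using assms by (auto simp: abs_le_iff)
qed

lemma integrand_continuous_s:
  assumes "continuous_on {-T..T} f" "t \<in> {-T..T}"
  shows "continuous_on {0..1} (\<lambda>s. S (t - t * s) (G (f (t * s))))"
  by (rule integrand_continuous)
    (use scaled_mem[OF assms(2)] in \<open>auto intro!: continuous_intros continuous_on_subset[OF assms(1)]\<close>)

text \<open>The bound \<open>h\<close> may vary with the scaled time: integrating
  \<open>s ^ k\<close> instead of a constant is what later produces the factorial in the uniqueness
  proof.\<close>

lemma duhamel_diff_le: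
  assumes f: "continuous_on {-T..T} f" and g: "continuous_on {-T..T} g" and t: "t \<in> {-T..T}"
    and h: "h integrable_on {0..1}"
    and le: "\<And>s. s \<in> {0..1} \<Longrightarrow> norm (G (f (t * s)) - G (g (t * s))) \<le> h s"
  shows "norm (duhamel f t - duhamel g t) \<le> \<bar>t\<bar> * integral {0..1} h"
proof -
  let ?i = "\<lambda>f s. S (t - t * s) (G (f (t * s)))"
  note int = integrand_continuous_s[OF _ t, THEN integrable_continuous_interval]
  have "duhamel f t - duhamel g t = t *\<^sub>R integral {0..1} (\<lambda>s. ?i f s - ?i g s)"
    unfolding duhamel_def
    by (simp add: integral_diff[OF int[OF f] int[OF g]] scaleR_right_diff_distrib)
  moreover have "norm (integral {0..1} (\<lambda>s. ?i f s - ?i g s)) \<le> integral {0..1} h"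
  proof (rule Henstock_Kurzweil_Integration.integral_norm_bound_integral)
    show "(\<lambda>s. ?i f s - ?i g s) integrable_on {0..1}"
      by (intro integrable_diff int f g)
    show "norm (?i f s - ?i g s) \<le> h s" if "s \<in> {0..1}" for s
      using le[OF that] S_norm S_diff by (metis order_trans)
  qed (rule h)
  ultimately show ?thesis
    by (simp add: mult_left_mono)
qed

lemma duhamel_diff_le_const:
  assumes f: "continuous_on {-T..T} f" and g: "continuous_on {-T..T} g" and t: "t \<in> {-T..T}"
    and le: "\<And>s. s \<in> {-T..T} \<Longrightarrow> norm (G (f s) - G (g s)) \<le> B"
  shows "norm (duhamel f t - duhamel g t) \<le> T * B"
proof -
  have "norm (duhamel f t - duhamel g t) \<le> \<bar>t\<bar> * integral {0..1} (\<lambda>_::real. B)"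
    using f g t by (rule duhamel_diff_le) (auto intro!: le scaled_mem[OF t, simplified])
  also have "\<dots> \<le> T * B"
    using t order_trans[OF norm_ge_zero le[OF t]] by (auto intro!: mult_right_mono)
  finally show ?thesis .
qed

lemma duhamel_0: "duhamel (\<lambda>_. 0) t = 0"
proof -
  have "S t 0 = 0" for t using S_diff[of t 0 0] by simp
  then show ?thesis by (simp add: duhamel_def G_0)
qed

text \<open>Scaling time makes the domain of integration independent of \<open>t\<close>, so this is
  continuity of a parameter integral with a jointly continuous integrand.\<close>

lemma duhamel_continuous:
  assumes "continuous_on {-T..T} f"
  shows "continuous_on {-T..T} (duhamel f)"
proof -
  have "continuous_on ({-T..T} \<times> cbox 0 1) (\<lambda>(t, s). S (t - t * s) (G (f (t * s))))"
    unfolding case_prod_unfold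
    by (rule integrand_continuous)
      (use scaled_mem[of _ T] in \<open>fastforce intro!: continuous_intros continuous_on_subset[OF assms(1)]\<close>)+
  from integral_continuous_on_param[OF this] show ?thesis
    unfolding duhamel_def[abs_def] by (auto intro!: continuous_intros)
qed

lemma S_cont_t: "continuous_on A (\<lambda>t. S t z)"
  using continuous_on_compose2[OF S_cont, of A "\<lambda>t. (t, z)"] by (simp add: continuous_on_Pair)

section \<open>Uniqueness of mild solutions\<close>

lemma norm_bound_on_interval:
  fixes f :: "real \<Rightarrow> 'a"
  assumes "continuous_on {-T..T} f"
  obtains R where "\<And>t. t \<in> {-T..T} \<Longrightarrow> norm (f t) \<le> R"
  using compact_imp_bounded[OF compact_continuous_image[OF assms compact_Icc]]
  unfolding bounded_iff by blast

text \<open>Here \<open>T\<close> is given and \<open>K\<close> depends on the size of the two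
  solutions, so \<open>K * T\<close> may be large and a single contraction estimate proves nothing.
  Compactness of the interval supplies a common bound \<open>R\<close>, hence one \<open>K\<close>
  for all iterations.\<close>

lemma mild_sol_unique:
  assumes f: "mild_sol T z f" and g: "mild_sol T z g" and t: "t \<in> {-T..T}"
  shows "f t = g t"
proof -
  have cf: "continuous_on {-T..T} f" and cg: "continuous_on {-T..T} g"
    using f g by (auto simp: mild_sol_def)
  obtain R1 where R1: "\<And>t. t \<in> {-T..T} \<Longrightarrow> norm (f t) \<le> R1"
    using norm_bound_on_interval[OF cf] by blast
  obtain R2 where R2: "\<And>t. t \<in> {-T..T} \<Longrightarrow> norm (g t) \<le> R2"
    using norm_bound_on_interval[OF cg] by blast
  define R where "R = max R1 R2"
  have Rf: "norm (f t) \<le> R" and Rg: "norm (g t) \<le> R" if "t \<in> {-T..T}" for t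
    using R1[OF that] R2[OF that] by (auto simp: R_def)
  obtain K where K: "K > 0" "\<And>x y. norm x \<le> R \<Longrightarrow> norm y \<le> R \<Longrightarrow> norm (G x - G y) \<le> K * norm (x - y)"
    using G_lip_pos by blast
  have bound: "norm (f t - g t) \<le> 2 * R * ((K * \<bar>t\<bar>) ^ k / fact k)" if "t \<in> {-T..T}" for k t
    using that
  proof (induction k arbitrary: t)
    case 0
    then show ?case
      using norm_triangle_ineq4[of "f t" "g t"] Rf[OF 0] Rg[OF 0] by simp
  next
    case (Suc k)
    \<comment> \<open>\<open>K\<close> times the induction hypothesis at time \<open>t * s\<close>;
      its power of the absolute value splits off \<open>s ^ k\<close>.\<close>
    let ?h = "\<lambda>s::real. (K * (2 * R * ((K * \<bar>t\<bar>) ^ k / fact k))) * s ^ k"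
    have h: "(?h has_integral (K * (2 * R * ((K * \<bar>t\<bar>) ^ k / fact k))) * (1 / (k + 1))) {0..1}"
    proof (rule has_integral_mult_right)
      have "((\<lambda>s. s ^ k) has_integral (1 ^ Suc k / real (Suc k) - 0 ^ Suc k / real (Suc k))) {0..1::real}"
        by (rule fundamental_theorem_of_calculus)
          (auto intro!: derivative_eq_intros simp: has_real_derivative_iff_has_vector_derivative[symmetric]
            simp del: of_nat_Suc power_Suc)
      then show "((\<lambda>s. s ^ k) has_integral 1 / real (k + 1)) {0..1::real}"
        by simp
    qed
    have "norm (f t - g t) = norm (duhamel f t - duhamel g t)"
      using f g Suc.prems by (simp add: mild_sol_def)
    also have "\<dots> \<le> \<bar>t\<bar> * integral {0..1} ?h"
    proof (rule duhamel_diff_le[OF cf cg Suc.prems])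
      show "?h integrable_on {0..1}" using h by blast
      fix s :: real
      assume s: "s \<in> {0..1}"
      note ts = scaled_mem[OF Suc.prems s]
      have "norm (G (f (t * s)) - G (g (t * s))) \<le> K * norm (f (t * s) - g (t * s))"
        by (intro K Rf Rg ts)
      also have "\<dots> \<le> K * (2 * R * ((K * \<bar>t * s\<bar>) ^ k / fact k))"
        using Suc.IH[OF ts] \<open>K > 0\<close> by (intro mult_left_mono) auto
      also have "\<dots> = ?h s"
        using s by (simp add: abs_mult power_mult_distrib)
      finally show "norm (G (f (t * s)) - G (g (t * s))) \<le> ?h s" .
    qed
    also have "\<dots> = 2 * R * ((K * \<bar>t\<bar>) ^ Suc k / fact (Suc k))"
      unfolding integral_unique[OF h] by (simp add: field_simps)
    finally show ?case .
  qed
  have "(\<lambda>k. (K * \<bar>t\<bar>) ^ k / fact k) \<longlonglongrightarrow> 0"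
    using summable_LIMSEQ_zero[OF summable_exp[of "K * \<bar>t\<bar>"]] by (simp add: divide_inverse mult.commute)
  then have "(\<lambda>k. 2 * R * ((K * \<bar>t\<bar>) ^ k / fact k)) \<longlonglongrightarrow> 2 * R * 0"
    by (rule tendsto_mult_left)
  then have "norm (f t - g t) \<le> 2 * R * 0"
    by (rule LIMSEQ_le_const) (use bound[OF t] in auto)
  then show ?thesis by simp
qed

section \<open>Existence by contraction, and Lipschitz dependence on the data\<close>

lemma mild_sol_exists:
  assumes T: "T > 0" and R: "norm z + T * (K * R) \<le> R" and "K > 0" "T * K \<le> 1/2" "R \<ge> 0"
    and K: "\<And>x y. norm x \<le> R \<Longrightarrow> norm y \<le> R \<Longrightarrow> norm (G x - G y) \<le> K * norm (x - y)"
  obtains f where "mild_sol T z f" "\<And>t. t \<in> {-T..T} \<Longrightarrow> norm (f t) \<le> R"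
proof -
  \<comment> \<open>The complete space for the fixed point consists of bounded continuous functions
    on the whole line. Clamping time by \<open>c\<close> defines \<open>\<Phi> f\<close> everywhere,
    constant beyond the two endpoints.\<close>
  define c where "c t = max (-T) (min T t)" for t
  have c: "c t \<in> {-T..T}" for t using T by (auto simp: c_def)
  have c_id: "c t = t" if "t \<in> {-T..T}" for t using that by (auto simp: c_def)
  have c_cont: "continuous_on A c" for A unfolding c_def by (intro continuous_intros)
  define \<Phi> where "\<Phi> f t = S (c t) z + duhamel f (c t)" for f t
  have ball: "norm (\<Phi> f t) \<le> R"
    if f: "continuous_on {-T..T} f" "\<And>t. norm (f t) \<le> R" for f t
  proof -
    \<comment> \<open>Comparison with the zero function, at which \<open>duhamel\<close> vanishes,
      turns the difference estimate into a bound.\<close>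
    have "norm (duhamel f (c t) - duhamel (\<lambda>_. 0) (c t)) \<le> T * (K * R)"
    proof (rule duhamel_diff_le_const[OF f(1) _ c])
      fix s
      have "norm (G (f s) - G 0) \<le> K * norm (f s)"
        using K[of "f s" 0] f(2)[of s] \<open>R \<ge> 0\<close> by simp
      also have "\<dots> \<le> K * R"
        using f(2)[of s] \<open>K > 0\<close> by simp
      finally show "norm (G (f s) - G 0) \<le> K * R" .
    qed auto
    then have "norm (duhamel f (c t)) \<le> T * (K * R)"
      by (simp add: duhamel_0)
    then show ?thesis
      unfolding \<Phi>_def using S_norm[of "c t" z] R norm_triangle_ineq[of "S (c t) z" "duhamel f (c t)"]
      by linarith
  qed
  have bc: "\<Phi> f \<in> bcontfun" if "continuous_on {-T..T} f" "\<And>t. norm (f t) \<le> R" for f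
  proof (rule bcontfun_normI)
    show "norm (\<Phi> f t) \<le> R" for t using ball that by blast
    show "continuous_on UNIV (\<Phi> f)"
      unfolding \<Phi>_def
      by (intro continuous_intros continuous_on_compose2[OF S_cont_t c_cont, of _ UNIV]
          continuous_on_compose2[OF duhamel_continuous[OF that(1)] c_cont])
         (use c in auto)
  qed
  \<comment> \<open>\<open>Bcontfun\<close> is controlled on bounded continuous arguments;
    \<open>bc\<close> guarantees this for functions in the ball, where the fixed point is
    sought.\<close>
  define P where "P F = Bcontfun (\<Phi> (apply_bcontfun F))" for F :: "real \<Rightarrow>\<^sub>C 'a"
  let ?B = "{F :: real \<Rightarrow>\<^sub>C 'a. norm F \<le> R}"
  have nb: "norm (F t) \<le> R" if "F \<in> ?B" for F :: "real \<Rightarrow>\<^sub>C 'a" and t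
    using that norm_bounded[of F t] by auto
  have cF: "continuous_on A (apply_bcontfun F)" for A and F :: "real \<Rightarrow>\<^sub>C 'a"
    using continuous_on_apply_bcontfun by auto
  have P: "apply_bcontfun (P F) = \<Phi> F" if "F \<in> ?B" for F
    unfolding P_def by (rule Bcontfun_inverse[OF bc]) (use nb[OF that] cF in auto)
  have "\<exists>!F\<in>?B. P F = F"
  proof (rule Banach_fix)
    have "?B = cball 0 R" by auto
    then show "complete ?B" by (simp add: complete_eq_closed)
    show "?B \<noteq> {}" using \<open>R \<ge> 0\<close> by (auto intro: exI[of _ 0])
    show "P ` ?B \<subseteq> ?B"
    proof clarsimp
      fix F :: "real \<Rightarrow>\<^sub>C 'a" assume F: "norm F \<le> R"
      show "norm (P F) \<le> R"
      proof (rule norm_bound)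
        show "norm (P F t) \<le> R" for t
          using P ball[OF cF nb] F by auto
      qed
    qed
    show "dist (P F) (P H) \<le> 1/2 * dist F H" if F: "F \<in> ?B" and H: "H \<in> ?B" for F H
    proof (rule dist_bound)
      fix t
      have "dist (P F t) (P H t) = norm (duhamel F (c t) - duhamel H (c t))"
        by (simp add: P[OF F] P[OF H] \<Phi>_def dist_norm)
      also have "\<dots> \<le> T * (K * dist F H)"
      proof (rule duhamel_diff_le_const[OF cF cF c])
        fix s
        have "norm (G (F s) - G (H s)) \<le> K * norm (F s - H s)"
          by (intro K nb F H)
        also have "\<dots> \<le> K * dist F H"
          using dist_bounded[of F s H] \<open>K > 0\<close> by (simp add: dist_norm)
        finally show "norm (G (F s) - G (H s)) \<le> K * dist F H" .
      qed
      also have "\<dots> \<le> 1/2 * dist F H"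
        using \<open>T * K \<le> 1/2\<close> mult_right_mono[of "T * K" "1/2" "dist F H"] by (simp add: mult.assoc)
      finally show "dist (P F t) (P H t) \<le> 1/2 * dist F H" .
    qed
  qed auto
  then obtain F where F: "F \<in> ?B" "P F = F" by blast
  have "F t = S t z + duhamel F t" if "t \<in> {-T..T}" for t
    using P[OF F(1)] F(2) by (metis \<Phi>_def c_id that)
  then have "mild_sol T z (apply_bcontfun F)"
    using cF by (simp add: mild_sol_def)
  then show ?thesis
    using nb[OF F(1)] by (rule that)
qed

text \<open>The norm of the difference attains its maximum \<open>D\<close> on the compact interval,
  and the Duhamel term there is at most \<open>D / 2\<close>. Absorbing it on the left gives the
  factor 2.\<close>

lemma mild_sol_lipschitz:
  assumes f: "mild_sol T z f" "\<And>t. t \<in> {-T..T} \<Longrightarrow> norm (f t) \<le> R"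
    and g: "mild_sol T w g" "\<And>t. t \<in> {-T..T} \<Longrightarrow> norm (g t) \<le> R"
    and "K > 0" "T > 0" "T * K \<le> 1/2"
    and K: "\<And>x y. norm x \<le> R \<Longrightarrow> norm y \<le> R \<Longrightarrow> norm (G x - G y) \<le> K * norm (x - y)"
    and t: "t \<in> {-T..T}"
  shows "norm (f t - g t) \<le> 2 * norm (z - w)"
proof -
  have cf: "continuous_on {-T..T} f" and cg: "continuous_on {-T..T} g"
    using f g by (auto simp: mild_sol_def)
  have "continuous_on {-T..T} (\<lambda>t. norm (f t - g t))"
    by (intro continuous_intros cf cg)
  then obtain m where m: "m \<in> {-T..T}" "\<And>s. s \<in> {-T..T} \<Longrightarrow> norm (f s - g s) \<le> norm (f m - g m)"
    using continuous_attains_sup[of "{-T..T}" "\<lambda>t. norm (f t - g t)"] \<open>T > 0\<close> by auto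
  define D where "D = norm (f m - g m)"
  have "norm (duhamel f m - duhamel g m) \<le> T * (K * D)"
  proof (rule duhamel_diff_le_const[OF cf cg m(1)])
    fix s assume s: "s \<in> {-T..T}"
    have "norm (G (f s) - G (g s)) \<le> K * norm (f s - g s)"
      by (intro K f g s)
    also have "\<dots> \<le> K * D"
      using m(2)[OF s] \<open>K > 0\<close> by (simp add: D_def)
    finally show "norm (G (f s) - G (g s)) \<le> K * D" .
  qed
  moreover have "T * (K * D) \<le> D / 2"
    using \<open>T * K \<le> 1/2\<close> mult_right_mono[of "T * K" "1/2" D] by (simp add: mult.assoc D_def)
  moreover have "f m - g m = S m (z - w) + (duhamel f m - duhamel g m)"
    using f g m(1) by (simp add: mild_sol_def S_diff)
  then have "D \<le> norm (z - w) + norm (duhamel f m - duhamel g m)"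
    unfolding D_def using S_norm[of m "z - w"] norm_triangle_ineq[of "S m (z - w)" "duhamel f m - duhamel g m"]
    by simp
  ultimately have "D \<le> 2 * norm (z - w)" by simp
  then show ?thesis using m(2)[OF t] by (simp add: D_def)
qed

text \<open>The time depends on the bound \<open>M\<close> and not on the individual datum, so a
  whole ball of data shares one interval; the estimate applies to arbitrary mild solutions, not
  merely to those built by contraction.\<close>

theorem mild_well_posed:
  assumes "M \<ge> 0"
  obtains T where "T > 0"
    "\<And>z. norm z \<le> M \<Longrightarrow> \<exists>f. mild_sol T z f"
    "\<And>z w f g t. norm z \<le> M \<Longrightarrow> norm w \<le> M \<Longrightarrow> mild_sol T z f \<Longrightarrow> mild_sol T w g
      \<Longrightarrow> t \<in> {-T..T} \<Longrightarrow> norm (f t - g t) \<le> 2 * norm (z - w)"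
proof -
  \<comment> \<open>Half of the radius is reserved for the data, half for the Duhamel term of size
    \<open>T * (K * R)\<close>, which equals \<open>M\<close> once \<open>T * K = 1/2\<close>. The
    same 1/2 is the contraction factor.\<close>
  define R where "R = 2 * M"
  obtain K where K: "K > 0" "\<And>x y. norm x \<le> R \<Longrightarrow> norm y \<le> R \<Longrightarrow> norm (G x - G y) \<le> K * norm (x - y)"
    using G_lip_pos by blast
  define T where "T = 1 / (2 * K)"
  have T: "T > 0" "T * K = 1/2" using K(1) by (simp_all add: T_def)
  have TKR: "T * (K * R) = M"
    using T(2) by (simp add: R_def flip: mult.assoc)
  have ex: "\<exists>f. mild_sol T z f \<and> (\<forall>t\<in>{-T..T}. norm (f t) \<le> R)" if "norm z \<le> M" for z
  proof (rule mild_sol_exists[OF T(1) _ K(1)])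
    show "norm z + T * (K * R) \<le> R"
      unfolding TKR using that by (simp add: R_def)
    show "T * K \<le> 1/2" "R \<ge> 0"
      using T(2) assms by (simp_all add: R_def)
  qed (use K(2) in auto)
  show ?thesis
  proof (rule that[OF T(1)])
    show "\<exists>f. mild_sol T z f" if "norm z \<le> M" for z
      using ex[OF that] by blast
    show "norm (f t - g t) \<le> 2 * norm (z - w)"
      if z: "norm z \<le> M" "norm w \<le> M" and f: "mild_sol T z f" and g: "mild_sol T w g"
        and t: "t \<in> {-T..T}" for z w f g t
    proof -
      \<comment> \<open>By uniqueness the given solutions coincide with the constructed ones, and
        this is what places them in the ball of radius \<open>R\<close>.\<close>
      have "norm (f s) \<le> R" "norm (g s) \<le> R" if "s \<in> {-T..T}" for s
        using ex[OF z(1)] ex[OF z(2)] mild_sol_unique[OF f _ that] mild_sol_unique[OF g _ that] that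
        by metis+
      then show ?thesis
        by (intro mild_sol_lipschitz[OF f _ g _ K(1) T(1) _ K(2) t]) (simp_all add: T)
    qed
  qed
qed

end

section \<open>Uniqueness of Fourier coefficients\<close>

lemma lattice_vec_add: "lattice_vec (m + n) = lattice_vec m + lattice_vec n"
  by (simp add: lattice_vec_def vec_eq_iff)

lemma lattice_vec_minus: "lattice_vec (- n) = - lattice_vec n"
  by (simp add: lattice_vec_def vec_eq_iff)

lemma frequency_inject:
  assumes "entries_int_independent \<omega>"
  shows "\<omega> \<bullet> lattice_vec m = \<omega> \<bullet> lattice_vec n \<longleftrightarrow> m = n"
proof
  assume "\<omega> \<bullet> lattice_vec m = \<omega> \<bullet> lattice_vec n"
  then have "(\<Sum>i\<in>UNIV. real_of_int ((m - n) $ i) * \<omega> $ i) = 0"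
    by (simp add: inner_vec_def lattice_vec_def algebra_simps sum_subtractf)
  then have "m - n = 0"
    using assms unfolding entries_int_independent_def by blast
  then show "m = n" by simp
qed simp

text \<open>At the point 0 all exponentials are 1, and unconditional convergence of a complex series
  is absolute.\<close>

lemma has_fourier_coeffs_summable:
  assumes "has_fourier_coeffs \<omega> u c"
  shows "(\<lambda>n. norm (c n)) summable_on UNIV"
proof -
  have "((\<lambda>n. c n * cis ((\<omega> \<bullet> lattice_vec n) * 0)) has_sum u 0) UNIV"
    using assms unfolding has_fourier_coeffs_def by blast
  then have "c summable_on UNIV"
    using has_sum_imp_summable by simp
  then show ?thesis
    by (simp add: summable_on_iff_abs_summable_on_complex)
qed

text \<open>The bound 1 must be uniform in \<open>F\<close>, because the modes outside
  \<open>F\<close> are later estimated by the absolute sum of \<open>c\<close>. Each induction step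
  multiplies by a factor of modulus at most 1, and the represented function stays 0 since translates
  of 0 are 0.\<close>

lemma annihilating_multiplier:
  assumes ind: "entries_int_independent \<omega>" and c: "has_fourier_coeffs \<omega> (\<lambda>_. 0) c"
    and "finite F" "m \<notin> F"
  shows "\<exists>g. (\<forall>n. norm (g n) \<le> 1) \<and> g m = 1 \<and> (\<forall>n\<in>F. g n = 0)
    \<and> has_fourier_coeffs \<omega> (\<lambda>_. 0) (\<lambda>n. c n * g n)"
  using assms(3,4)
proof (induction F)
  case empty
  then show ?case using c by (intro exI[of _ "\<lambda>_. 1"]) simp
next
  case (insert k F)
  then obtain g where g: "\<And>n. norm (g n) \<le> 1" "g m = 1" "\<And>n. n \<in> F \<Longrightarrow> g n = 0"
    "has_fourier_coeffs \<omega> (\<lambda>_. 0) (\<lambda>n. c n * g n)"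
    by auto
  let ?\<theta> = "\<lambda>n. \<omega> \<bullet> lattice_vec n"
  \<comment> \<open>Averaging the function with its modulated translate by h keeps the mode m and kills the mode k.\<close>
  define h where "h = pi / (?\<theta> k - ?\<theta> m)"
  define g' where "g' n = g n * ((1 + cis ((?\<theta> n - ?\<theta> m) * h)) / 2)" for n
  have "norm (g' n) \<le> 1" for n
  proof -
    have "norm (1 + cis ((?\<theta> n - ?\<theta> m) * h)) \<le> 2"
      using norm_triangle_ineq[of 1 "cis ((?\<theta> n - ?\<theta> m) * h)"] by simp
    then show ?thesis
      unfolding g'_def norm_mult using g(1)[of n] by (intro mult_le_one) (auto simp: norm_divide)
  qed
  moreover have "g' m = 1" by (simp add: g'_def g)
  moreover have "g' n = 0" if "n \<in> insert k F" for n
  proof (cases "n = k")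
    case True
    have "?\<theta> k - ?\<theta> m \<noteq> 0"
      using insert.prems frequency_inject[OF ind, of k m] by auto
    then have "cis ((?\<theta> k - ?\<theta> m) * h) = -1"
      by (simp add: h_def)
    then show ?thesis using True by (simp add: g'_def)
  qed (use that g(3) in \<open>simp add: g'_def\<close>)
  moreover have "has_fourier_coeffs \<omega> (\<lambda>_. 0) (\<lambda>n. c n * g' n)"
    unfolding has_fourier_coeffs_def
  proof
    fix x
    have "((\<lambda>n. c n * g n * cis (?\<theta> n * y)) has_sum 0) UNIV" for y
      using g(4) unfolding has_fourier_coeffs_def by blast
    from has_sum_cmult_right[OF has_sum_add[OF this[of x] has_sum_cmult_right[OF this[of "x + h"], of "cis (- ?\<theta> m * h)"]], of "1/2"]
    have "((\<lambda>n. 1/2 * (c n * g n * cis (?\<theta> n * x) + cis (- ?\<theta> m * h) * (c n * g n * cis (?\<theta> n * (x + h))))) has_sum 0) UNIV"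
      by simp
    moreover have "1/2 * (c n * g n * cis (?\<theta> n * x) + cis (- ?\<theta> m * h) * (c n * g n * cis (?\<theta> n * (x + h))))
        = c n * g' n * cis (?\<theta> n * x)" for n
    proof -
      have "cis (- ?\<theta> m * h) * cis (?\<theta> n * (x + h)) = cis ((?\<theta> n - ?\<theta> m) * h) * cis (?\<theta> n * x)"
        by (simp add: cis_mult algebra_simps)
      then show ?thesis
        by (simp add: g'_def field_simps)
    qed
    ultimately show "((\<lambda>n. c n * g' n * cis (?\<theta> n * x)) has_sum 0) UNIV"
      by simp
  qed
  ultimately show ?case by blast
qed

text \<open>Evaluating the zero function with coefficients \<open>c n * g n\<close> at 0 leaves
  \<open>c m\<close> plus the modes outside a finite set that carries the absolute sum up to
  \<open>e\<close>; hence \<open>c m\<close> is as small as that tail.\<close>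

lemma fourier_coeffs_of_zero:
  assumes ind: "entries_int_independent \<omega>" and c: "has_fourier_coeffs \<omega> (\<lambda>_. 0) c"
  shows "c m = 0"
proof -
  note abs = has_fourier_coeffs_summable[OF c]
  let ?A = "\<Sum>\<^sub>\<infinity>n. norm (c n)"
  have "norm (c m) \<le> 0 + e" if e: "e > 0" for e
  proof -
    obtain F0 where F0: "finite F0" "dist (\<Sum>n\<in>F0. norm (c n)) ?A \<le> e"
      using infsum_finite_approximation[OF abs e] by blast
    \<comment> \<open>\<open>m\<close> is taken out so that the multiplier can be 1 there; putting
      it back afterwards can only decrease the tail.\<close>
    define F where "F = F0 - {m}"
    have F: "finite F" "m \<notin> F" using F0 by (auto simp: F_def)
    obtain g where g: "\<And>n. norm (g n) \<le> 1" "g m = 1" "\<And>n. n \<in> F \<Longrightarrow> g n = 0"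
      "has_fourier_coeffs \<omega> (\<lambda>_. 0) (\<lambda>n. c n * g n)"
      using annihilating_multiplier[OF ind c F] by blast
    have "((\<lambda>n. c n * g n * cis ((\<omega> \<bullet> lattice_vec n) * 0)) has_sum 0) UNIV"
      using g(4) unfolding has_fourier_coeffs_def by blast
    then have "((\<lambda>n. c n * g n) has_sum 0) UNIV" by simp
    moreover have "((\<lambda>n. c n * g n) has_sum (\<Sum>n\<in>insert m F. c n * g n)) (insert m F)"
      using F by (intro has_sum_finite) auto
    ultimately have "((\<lambda>n. c n * g n) has_sum (0 - (\<Sum>n\<in>insert m F. c n * g n))) (UNIV - insert m F)"
      by (rule has_sum_Diff) simp
    moreover have "(\<Sum>n\<in>insert m F. c n * g n) = c m"
      using F g by simp
    ultimately have *: "((\<lambda>n. c n * g n) has_sum - c m) (UNIV - insert m F)"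
      by simp
    have "((\<lambda>n. norm (c n)) has_sum (?A - (\<Sum>n\<in>insert m F. norm (c n)))) (UNIV - insert m F)"
      using F abs by (intro has_sum_Diff has_sum_finite has_sum_infsum) auto
    with * have "norm (- c m) \<le> ?A - (\<Sum>n\<in>insert m F. norm (c n))"
      by (rule norm_infsum_le) (simp only: norm_mult, intro mult_left_le g(1) norm_ge_zero)
    moreover have "(\<Sum>n\<in>F0. norm (c n)) \<le> (\<Sum>n\<in>insert m F. norm (c n))"
      using F by (intro sum_mono2) (auto simp: F_def)
    ultimately show ?thesis using F0(2) by (simp add: dist_real_def)
  qed
  then have "norm (c m) \<le> 0" by (rule field_le_epsilon)
  then show ?thesis by simp
qed

lemma fourier_coeffs_unique:
  assumes ind: "entries_int_independent \<omega>"
    and "has_fourier_coeffs \<omega> u c" "has_fourier_coeffs \<omega> u d"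
  shows "c = d"
proof
  fix n
  have "has_fourier_coeffs \<omega> (\<lambda>_. 0) (\<lambda>n. c n - d n)"
    unfolding has_fourier_coeffs_def
  proof
    fix x
    have "((\<lambda>n. c n * cis ((\<omega> \<bullet> lattice_vec n) * x) + - (d n * cis ((\<omega> \<bullet> lattice_vec n) * x))) has_sum u x + - u x) UNIV"
      using assms unfolding has_fourier_coeffs_def by (intro has_sum_add has_sum_uminusI) auto
    then show "((\<lambda>n. (c n - d n) * cis ((\<omega> \<bullet> lattice_vec n) * x)) has_sum 0) UNIV"
      by (simp add: left_diff_distrib)
  qed
  from fourier_coeffs_of_zero[OF ind this, of n] show "c n = d n" by simp
qed

lemma fourier_coeff_eq:
  assumes "entries_int_independent \<omega>" "has_fourier_coeffs \<omega> u c"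
  shows "fourier_coeff \<omega> u = c"
  unfolding fourier_coeff_def using assms fourier_coeffs_unique by (intro the_equality)

section \<open>Multipliers and products on summable families\<close>

lemma has_sum_product:
  fixes f :: "'a \<Rightarrow> 'c :: {real_normed_field, banach}" and g :: "'b \<Rightarrow> 'c"
  assumes f: "(f has_sum a) UNIV" "(\<lambda>i. norm (f i)) summable_on UNIV"
    and g: "(g has_sum b) UNIV" "(\<lambda>i. norm (g i)) summable_on UNIV"
  shows "((\<lambda>(i, j). f i * g j) has_sum a * b) (UNIV \<times> UNIV)"
proof (rule has_sum_SigmaI)
  show "((\<lambda>j. case (i, j) of (i, j) \<Rightarrow> f i * g j) has_sum f i * b) UNIV" for i
    using has_sum_cmult_right[OF g(1)] by simp
  show "((\<lambda>i. f i * b) has_sum a * b) UNIV"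
    using has_sum_cmult_left[OF f(1)] .
  have "(\<lambda>p. norm (case p of (i, j) \<Rightarrow> f i * g j)) summable_on UNIV \<times> UNIV"
    by (subst Infinite_Sum.abs_summable_on_Sigma_iff)
      (simp add: norm_mult infsum_cmult_right' summable_on_cmult_right summable_on_cmult_left abs_mult infsum_nonneg f g)
  then show "(\<lambda>(i, j). f i * g j) summable_on UNIV \<times> UNIV"
    by (rule Infinite_Sum.abs_summable_summable)
qed

text \<open>The absolutely convergent double series is regrouped along \<open>i + j = k\<close>. The
  general field serves both the complex series of a product and the real series of norms that
  dominates it.\<close>

lemma has_sum_convolution:
  fixes f g :: "'a :: ab_group_add \<Rightarrow> 'c :: {real_normed_field, banach}"
  assumes "(f has_sum a) UNIV" "(\<lambda>i. norm (f i)) summable_on UNIV"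
    and "(g has_sum b) UNIV" "(\<lambda>i. norm (g i)) summable_on UNIV"
  shows "(\<lambda>i. f i * g (k - i)) summable_on UNIV"
    and "((\<lambda>k. \<Sum>\<^sub>\<infinity>i. f i * g (k - i)) has_sum a * b) UNIV"
proof -
  have *: "((\<lambda>(k, i). f i * g (k - i)) has_sum a * b) (UNIV \<times> UNIV)"
    using has_sum_product[OF assms]
    by (rule iffD1[OF has_sum_reindex_bij_witness[where i = "\<lambda>(k, i). (i, k - i)" and j = "\<lambda>(i, j). (i + j, i)"], rotated -1])
      auto
  show s: "(\<lambda>i. f i * g (k - i)) summable_on UNIV" for k
  proof (rule Infinite_Sum.abs_summable_summable, rule Infinite_Sum.abs_summable_on_comparison_test')
    show "(\<lambda>i. norm (f i) * (\<Sum>\<^sub>\<infinity>j. norm (g j))) summable_on UNIV"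
      using assms(2) by (rule summable_on_cmult_left)
    have "norm (g j) \<le> (\<Sum>\<^sub>\<infinity>j. norm (g j))" for j
      using finite_sum_le_infsum[OF assms(4), of "{j}"] by simp
    then show "norm (f i * g (k - i)) \<le> norm (f i) * (\<Sum>\<^sub>\<infinity>j. norm (g j))" for i
      by (simp add: norm_mult mult_left_mono)
  qed
  show "((\<lambda>k. \<Sum>\<^sub>\<infinity>i. f i * g (k - i)) has_sum a * b) UNIV"
    by (rule has_sum_SigmaD[OF *]) (simp add: has_sum_infsum s)
qed

text \<open>Covers the propagator as well as multiplication by a complex constant, as
  \<open>l1\<close> is made a vector space over the reals.\<close>

definition multiplier :: "('a \<Rightarrow> complex) \<Rightarrow> 'a l1 \<Rightarrow> 'a l1" where
  "multiplier g z = Abs_l1 (\<lambda>n. g n * coord z n)"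

lemma multiplier_summable:
  assumes "\<And>n. norm (g n) \<le> 1"
  shows "(\<lambda>n. norm (g n * coord z n)) summable_on UNIV"
  by (rule summable_on_comparison_test[OF coord_abs_summable[of z]])
    (simp_all add: norm_mult mult_left_le_one_le assms)

lemma coord_multiplier:
  assumes "\<And>n. norm (g n) \<le> 1"
  shows "coord (multiplier g z) n = g n * coord z n"
  by (simp add: multiplier_def coord_Abs_l1[OF multiplier_summable[of g, OF assms]])

lemma norm_multiplier_le:
  assumes "\<And>n. norm (g n) \<le> 1"
  shows "norm (multiplier g z) \<le> norm z"
  unfolding norm_l1_eq coord_multiplier[of g, OF assms]
  by (rule infsum_mono[OF multiplier_summable[OF assms] coord_abs_summable])
    (simp_all add: norm_mult mult_left_le_one_le assms)

lemma multiplier_diff: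
  assumes "\<And>n. norm (g n) \<le> 1"
  shows "multiplier g (z - w) = multiplier g z - multiplier g w"
  by (rule l1_eqI) (simp add: coord_multiplier[of g, OF assms] right_diff_distrib)

definition schroedinger_group :: "('a \<Rightarrow> real) \<Rightarrow> real \<Rightarrow> 'a l1 \<Rightarrow> 'a l1" where
  "schroedinger_group \<theta> t = multiplier (\<lambda>n. cis (- t * (\<theta> n)\<^sup>2))"

lemma coord_schroedinger_group: "coord (schroedinger_group \<theta> t z) n = cis (- t * (\<theta> n)\<^sup>2) * coord z n"
  unfolding schroedinger_group_def by (rule coord_multiplier) simp

text \<open>For a fixed vector the Weierstrass test with majorant
  \<open>2 * norm (coord z n)\<close> gives continuity in time. Contractivity makes it joint: the
  change of vector is estimated uniformly in time, and the change of time at the fixed limit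
  vector.\<close>

lemma continuous_schroedinger_group:
  "continuous_on UNIV (\<lambda>(t, z). schroedinger_group \<theta> t z)"
proof -
  let ?S = "schroedinger_group \<theta>"
  have strong: "((\<lambda>t. norm (?S t z - ?S s z)) \<longlongrightarrow> 0) (at s within A)" for z s A
  proof -
    let ?f = "\<lambda>t n. norm (cis (- t * (\<theta> n)\<^sup>2) * coord z n - cis (- s * (\<theta> n)\<^sup>2) * coord z n)"
    have "norm (?f t n) \<le> 2 * norm (coord z n)" for t n
      using norm_triangle_ineq4[of "cis (- t * (\<theta> n)\<^sup>2) * coord z n" "cis (- s * (\<theta> n)\<^sup>2) * coord z n"]
      by (simp add: norm_mult)
    then have "uniform_limit UNIV (\<lambda>X t. \<Sum>n\<in>X. ?f t n) (\<lambda>t. \<Sum>\<^sub>\<infinity>n. ?f t n) (finite_subsets_at_top UNIV)"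
      by (intro Weierstrass_m_test_general[of _ _ _ "\<lambda>n. 2 * norm (coord z n)"])
        (auto intro: summable_on_cmult_right coord_abs_summable)
    then have "continuous_on UNIV (\<lambda>t. \<Sum>\<^sub>\<infinity>n. ?f t n)"
      by (rule uniform_limit_theorem[rotated])
        (auto intro!: always_eventually continuous_intros)
    moreover have "(\<Sum>\<^sub>\<infinity>n. ?f t n) = norm (?S t z - ?S s z)" for t
      by (simp add: norm_l1_eq coord_schroedinger_group)
    ultimately have "continuous_on UNIV (\<lambda>t. norm (?S t z - ?S s z))"
      by simp
    then have "isCont (\<lambda>t. norm (?S t z - ?S s z)) s"
      by (simp add: continuous_on_eq_continuous_at)
    then show ?thesis
      unfolding isCont_def using tendsto_within_subset[of _ _ s UNIV A] by simp
  qed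
  show ?thesis
    unfolding continuous_on_def
  proof (intro ballI)
    fix p :: "real \<times> 'a l1"
    obtain s w where p: "p = (s, w)" by force
    have "((\<lambda>q. norm (snd q - w) + norm (?S (fst q) w - ?S s w)) \<longlongrightarrow> norm (snd p - w) + 0) (at p)"
    proof (intro tendsto_intros)
      \<comment> \<open>The filter is \<open>nhds\<close> and not \<open>at\<close>, since a point
        different from \<open>p\<close> may still have time component \<open>s\<close>.\<close>
      have "((\<lambda>t. norm (?S t w - ?S s w)) \<longlongrightarrow> 0) (nhds s)"
        using strong[of w s UNIV] by (simp add: tendsto_nhds_iff)
      moreover have "filterlim fst (nhds s) (at p)"
        using tendsto_fst[OF tendsto_ident_at[of p UNIV]] by (simp add: p)
      ultimately show "((\<lambda>q. norm (?S (fst q) w - ?S s w)) \<longlongrightarrow> 0) (at p)"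
        by (rule filterlim_compose)
    qed
    then have lim: "((\<lambda>q. norm (snd q - w) + norm (?S (fst q) w - ?S s w)) \<longlongrightarrow> 0) (at p)"
      by (simp add: p)
    have "norm (?S (fst q) (snd q) - ?S s w) \<le> norm (snd q - w) + norm (?S (fst q) w - ?S s w)" for q
    proof -
      have "?S (fst q) (snd q) - ?S s w = ?S (fst q) (snd q - w) + (?S (fst q) w - ?S s w)"
        unfolding schroedinger_group_def by (simp add: multiplier_diff)
      moreover have "norm (?S (fst q) (snd q - w)) \<le> norm (snd q - w)"
        unfolding schroedinger_group_def by (rule norm_multiplier_le) simp
      ultimately show ?thesis
        by (metis add_right_mono norm_triangle_mono order_refl)
    qed
    then have "((\<lambda>q. ?S (fst q) (snd q) - ?S s w) \<longlongrightarrow> 0) (at p)"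
      by (intro Lim_null_comparison[OF always_eventually lim]) blast
    then show "((\<lambda>(t, z). ?S t z) \<longlongrightarrow> (case p of (t, z) \<Rightarrow> ?S t z)) (at p)"
      by (simp add: case_prod_unfold p LIM_zero_cancel)
  qed
qed

text \<open>One constant for each ball, as in \<open>G_lip\<close>; in infinite dimension this is
  stronger than a constant near each point.\<close>

definition locally_lipschitz :: "('a::real_normed_vector \<Rightarrow> 'b::real_normed_vector) \<Rightarrow> bool" where
  "locally_lipschitz H \<longleftrightarrow>
     (\<forall>R. \<exists>K. \<forall>x y. norm x \<le> R \<longrightarrow> norm y \<le> R \<longrightarrow> norm (H x - H y) \<le> K * norm (x - y))"

lemma locally_lipschitzE:
  assumes "locally_lipschitz H"
  obtains K B where "K \<ge> 0" "B \<ge> 0" "\<And>x. norm x \<le> R \<Longrightarrow> norm (H x) \<le> B"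
    "\<And>x y. norm x \<le> R \<Longrightarrow> norm y \<le> R \<Longrightarrow> norm (H x - H y) \<le> K * norm (x - y)"
proof -
  \<comment> \<open>With the absolute value, 0 lies in the ball for every real \<open>R\<close>, so
    that \<open>H 0\<close> can serve to bound \<open>H\<close>.\<close>
  obtain K where K: "\<And>x y. norm x \<le> \<bar>R\<bar> \<Longrightarrow> norm y \<le> \<bar>R\<bar> \<Longrightarrow> norm (H x - H y) \<le> K * norm (x - y)"
    using assms unfolding locally_lipschitz_def by blast
  have K': "norm (H x - H y) \<le> \<bar>K\<bar> * norm (x - y)" if "norm x \<le> \<bar>R\<bar>" "norm y \<le> \<bar>R\<bar>" for x y
    using K[OF that] mult_right_mono[OF abs_ge_self[of K], of "norm (x - y)"] by simp
  show ?thesis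
  proof (rule that[of "\<bar>K\<bar>" "norm (H 0) + \<bar>K\<bar> * \<bar>R\<bar>"])
    fix x :: 'a
    assume "norm x \<le> R"
    then have x: "norm x \<le> \<bar>R\<bar>" by simp
    have "norm (H x - H 0) \<le> \<bar>K\<bar> * norm x"
      using K'[OF x, of 0] by simp
    also have "\<dots> \<le> \<bar>K\<bar> * \<bar>R\<bar>"
      using x by (intro mult_left_mono) auto
    finally show "norm (H x) \<le> norm (H 0) + \<bar>K\<bar> * \<bar>R\<bar>"
      using norm_triangle_sub[of "H x" "H 0"] by simp
  qed (use K' in auto)
qed

section \<open>Fourier synthesis\<close>

locale fourier_weight =
  fixes \<omega> :: "real ^ 'n::finite" and wt :: "real \<Rightarrow> real"
  assumes indep: "entries_int_independent \<omega>"
    and wt_pos: "\<forall>q\<ge>0. wt q > 0"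
    and wt_mono: "mono_on {0..} wt"
    and wt_bounded_below: "\<exists>c>0. \<forall>q\<ge>0. c \<le> wt q"
    and wt_submult: "\<forall>q\<ge>0. \<forall>r\<ge>0. wt (q + r) \<le> wt q * wt r"
begin

abbreviation \<theta> :: "int ^ 'n \<Rightarrow> real" where "\<theta> n \<equiv> \<omega> \<bullet> lattice_vec n"

abbreviation W :: "int ^ 'n \<Rightarrow> real" where "W n \<equiv> wt (norm (lattice_vec n))"

lemma W_pos: "W n > 0"
  using wt_pos by simp

text \<open>The source of the algebra property: in a convolution the weight at \<open>k\<close> is
  distributed over \<open>m\<close> and \<open>k - m\<close>. Monotonicity carries the triangle
  inequality through the weight.\<close>

lemma W_add_le: "W (m + n) \<le> W m * W n"
proof -
  have "W (m + n) \<le> wt (norm (lattice_vec m) + norm (lattice_vec n))"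
    by (rule mono_onD[OF wt_mono]) (simp_all add: lattice_vec_add norm_triangle_ineq)
  also have "\<dots> \<le> W m * W n"
    using wt_submult by simp
  finally show ?thesis .
qed

lemma W_lower_bound:
  obtains \<beta> where "\<beta> > 0" "\<And>n. \<beta> \<le> W n"
  using wt_bounded_below by (meson norm_ge_zero)

definition synth :: "(int ^ 'n) l1 \<Rightarrow> real \<Rightarrow> complex" where
  "synth z x = (\<Sum>\<^sub>\<infinity>n. coord z n / W n * cis (\<theta> n * x))"

lemma unweighted_summable: "(\<lambda>n. norm (coord z n / W n)) summable_on UNIV"
proof -
  obtain \<beta> where \<beta>: "\<beta> > 0" "\<And>n. \<beta> \<le> W n"
    using W_lower_bound by blast
  have "(\<lambda>n. norm (coord z n) * (1 / \<beta>)) summable_on UNIV"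
    by (intro summable_on_cmult_left coord_abs_summable)
  then show ?thesis
    by (rule Infinite_Sum.abs_summable_on_comparison_test')
      (use \<beta> W_pos in \<open>auto simp: norm_divide abs_of_pos intro!: divide_left_mono mult_pos_pos\<close>)
qed

lemma has_fourier_coeffs_synth: "has_fourier_coeffs \<omega> (synth z) (\<lambda>n. coord z n / W n)"
  unfolding has_fourier_coeffs_def synth_def
proof
  fix x
  have "(\<lambda>n. coord z n / W n * cis (\<theta> n * x)) summable_on UNIV"
    by (rule Infinite_Sum.abs_summable_summable) (use unweighted_summable[of z] in \<open>simp add: norm_mult del: times_divide_eq_left\<close>)
  then show "((\<lambda>n. coord z n / W n * cis (\<theta> n * x)) has_sum
      (\<Sum>\<^sub>\<infinity>n. coord z n / W n * cis (\<theta> n * x))) UNIV"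
    by simp
qed

lemma synth_has_sum: "((\<lambda>n. coord z n / W n * cis (\<theta> n * x)) has_sum synth z x) UNIV"
  using has_fourier_coeffs_synth unfolding has_fourier_coeffs_def by blast

lemma fourier_coeff_synth: "fourier_coeff \<omega> (synth z) = (\<lambda>n. coord z n / W n)"
  by (rule fourier_coeff_eq[OF indep has_fourier_coeffs_synth])

lemma synth_eqI:
  assumes "\<And>x. ((\<lambda>n. c n * cis (\<theta> n * x)) has_sum u x) UNIV" "\<And>n. coord z n = c n * W n"
  shows "synth z = u"
proof
  fix x
  have "((\<lambda>n. c n * cis (\<theta> n * x)) has_sum synth z x) UNIV"
    using synth_has_sum[of z x] W_pos by (simp add: assms(2) less_imp_neq[THEN not_sym])
  then show "synth z x = u x"
    using assms(1) has_sum_unique by blast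
qed

lemma synth_inject: "synth z = synth w \<longleftrightarrow> z = w"
proof
  assume "synth z = synth w"
  then have "coord z n / W n = coord w n / W n" for n
    using fourier_coeff_synth by metis
  then show "z = w"
    using W_pos by (intro l1_eqI) (simp add: less_imp_neq[THEN not_sym])
qed simp

lemma A_norm_synth: "A_norm \<omega> wt (synth z) = norm z"
proof -
  have "cmod (coord z n / W n) * W n = cmod (coord z n)" for n
    using W_pos[of n] by (simp add: norm_divide)
  then show ?thesis
    by (simp add: A_norm_def fourier_coeff_synth norm_l1_eq)
qed

lemma A_space_eq: "A_space \<omega> wt = range synth"
proof (intro set_eqI iffI)
  fix u assume "u \<in> A_space \<omega> wt"
  then obtain c where c: "has_fourier_coeffs \<omega> u c" "(\<lambda>n. cmod (c n) * W n) summable_on UNIV"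
    unfolding A_space_def by blast
  have "norm (c n * W n) = cmod (c n) * W n" for n
    using W_pos[of n] by (simp add: norm_mult)
  then have "coord (Abs_l1 (\<lambda>n. c n * W n)) = (\<lambda>n. c n * W n)"
    using c(2) by (intro coord_Abs_l1) simp
  then have "synth (Abs_l1 (\<lambda>n. c n * W n)) = u"
    using c(1) by (intro synth_eqI[where c = c]) (auto simp: has_fourier_coeffs_def)
  then show "u \<in> range synth" by blast
next
  fix u assume "u \<in> range synth"
  then obtain z where z: "u = synth z" by blast
  have "cmod (coord z n / W n) * W n = cmod (coord z n)" for n
    using W_pos[of n] by (simp add: norm_divide)
  then show "u \<in> A_space \<omega> wt"
    unfolding A_space_def z using has_fourier_coeffs_synth[of z] coord_abs_summable[of z] by auto
qed

lemma synth_add: "synth (z + w) x = synth z x + synth w x"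
proof -
  have "((\<lambda>n. coord (z + w) n / W n * cis (\<theta> n * x)) has_sum synth z x + synth w x) UNIV"
    using has_sum_add[OF synth_has_sum[of z x] synth_has_sum[of w x]]
    by (simp add: add_divide_distrib distrib_right)
  then show ?thesis
    using synth_has_sum has_sum_unique by blast
qed

lemma synth_scaleR: "synth (r *\<^sub>R z) x = r *\<^sub>R synth z x"
proof -
  have "((\<lambda>n. coord (r *\<^sub>R z) n / W n * cis (\<theta> n * x)) has_sum r *\<^sub>R synth z x) UNIV"
    using has_sum_cmult_right[OF synth_has_sum[of z x], of "of_real r"]
    by (simp add: scaleR_conv_of_real mult.assoc)
  then show ?thesis
    using synth_has_sum has_sum_unique by blast
qed

lemma synth_multiplier:
  assumes "\<And>n. norm (g n) \<le> 1"
  shows "synth (multiplier g z) x = (\<Sum>\<^sub>\<infinity>n. g n * (coord z n / W n) * cis (\<theta> n * x))"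
  by (simp add: synth_def coord_multiplier[of g, OF assms])

lemma synth_bounded_linear: "bounded_linear (\<lambda>z. synth z x)"
proof -
  obtain \<beta> where \<beta>: "\<beta> > 0" "\<And>n. \<beta> \<le> W n"
    using W_lower_bound by blast
  show ?thesis
  proof (rule bounded_linear_intro[where K = "1 / \<beta>"])
    fix z :: "(int ^ 'n) l1"
    have "((\<lambda>n. norm (coord z n) * (1 / \<beta>)) has_sum norm z * (1 / \<beta>)) UNIV"
      unfolding norm_l1_eq by (intro has_sum_cmult_left has_sum_infsum coord_abs_summable)
    with synth_has_sum[of z x] show "norm (synth z x) \<le> norm z * (1 / \<beta>)"
      by (rule norm_infsum_le)
        (use \<beta> W_pos in \<open>auto simp: norm_mult norm_divide abs_of_pos intro!: divide_left_mono mult_pos_pos\<close>)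
  qed (simp_all add: synth_add synth_scaleR)
qed

lemma synth_diff: "synth (z - w) = synth z - synth w"
proof
  show "synth (z - w) x = (synth z - synth w) x" for x
    using synth_add[of "z - w" w x] by simp
qed

lemma synth_0: "synth 0 = (\<lambda>_. 0)"
  using synth_diff[of 0 0] by (simp add: fun_eq_iff)

definition coeffs :: "(real \<Rightarrow> complex) \<Rightarrow> (int ^ 'n) l1" where
  "coeffs = inv synth"

lemma coeffs_synth [simp]: "coeffs (synth z) = z"
  unfolding coeffs_def by (rule inv_f_f) (simp add: inj_def synth_inject)

lemma synth_coeffs: "u \<in> A_space \<omega> wt \<Longrightarrow> synth (coeffs u) = u"
  by (auto simp: A_space_eq)

lemma propagator_synth: "propagator \<omega> t (synth z) = synth (schroedinger_group \<theta> t z)"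
  by (simp add: fun_eq_iff propagator_def fourier_coeff_synth schroedinger_group_def synth_multiplier)

section \<open>Scalars, products, conjugates and the power nonlinearity\<close>

lemma synth_mult_const:
  assumes "norm \<kappa> \<le> 1"
  shows "synth (multiplier (\<lambda>_. \<kappa>) z) x = \<kappa> * synth z x"
proof -
  have "coord (multiplier (\<lambda>_. \<kappa>) z) n / W n * cis (\<theta> n * x)
      = \<kappa> * (coord z n / W n * cis (\<theta> n * x))" for n
    using assms by (simp add: coord_multiplier)
  then show ?thesis
    unfolding synth_def by (simp only: infsum_cmult_right')
qed

text \<open>The convolution \<open>c\<close> of the unweighted coefficients represents the pointwise
  product. With the weight restored it is dominated by \<open>q\<close>, the convolution of the
  coordinate norms, whose total is \<open>norm z * norm w\<close>.\<close>

lemma synth_mult_ex: "\<exists>y. synth y = (\<lambda>x. synth z x * synth w x) \<and> norm y \<le> norm z * norm w"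
proof -
  define a where "a n = coord z n / W n" for n
  define b where "b n = coord w n / W n" for n
  define c where "c k = (\<Sum>\<^sub>\<infinity>m. a m * b (k - m))" for k
  have a: "(\<lambda>n. norm (a n)) summable_on UNIV" and b: "(\<lambda>n. norm (b n)) summable_on UNIV"
    unfolding a_def b_def by (rule unweighted_summable)+
  have c_sum: "((\<lambda>k. c k * cis (\<theta> k * x)) has_sum synth z x * synth w x) UNIV" for x
  proof -
    have "((\<lambda>k. \<Sum>\<^sub>\<infinity>m. (a m * cis (\<theta> m * x)) * (b (k - m) * cis (\<theta> (k - m) * x)))
        has_sum synth z x * synth w x) UNIV"
      using a b synth_has_sum[of z x] synth_has_sum[of w x]
      by (intro has_sum_convolution(2)) (simp_all add: a_def b_def norm_mult del: times_divide_eq_left)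
    moreover have "(\<Sum>\<^sub>\<infinity>m. (a m * cis (\<theta> m * x)) * (b (k - m) * cis (\<theta> (k - m) * x)))
        = c k * cis (\<theta> k * x)" for k
    proof -
      have "lattice_vec k = lattice_vec m + lattice_vec (k - m)" for m
        by (simp flip: lattice_vec_add)
      then have "cis (\<theta> k * x) = cis (\<theta> m * x) * cis (\<theta> (k - m) * x)" for m
        by (metis cis_mult distrib_right inner_add_right)
      then have "(a m * cis (\<theta> m * x)) * (b (k - m) * cis (\<theta> (k - m) * x))
          = a m * b (k - m) * cis (\<theta> k * x)" for m
        by simp
      then show ?thesis
        unfolding c_def by (simp only: infsum_cmult_left')
    qed
    ultimately show ?thesis by simp
  qed
  define q where "q k = (\<Sum>\<^sub>\<infinity>m. norm (coord z m) * norm (coord w (k - m)))" for k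
  have hz: "((\<lambda>n. norm (coord z n)) has_sum norm z) UNIV" for z :: "(int ^ 'n) l1"
    unfolding norm_l1_eq by (intro has_sum_infsum coord_abs_summable)
  have q: "(\<lambda>m. norm (coord z m) * norm (coord w (k - m))) summable_on UNIV"
    "(q has_sum norm z * norm w) UNIV" for k
    using has_sum_convolution[OF hz _ hz, of z w] by (simp_all add: q_def[abs_def] coord_abs_summable)
  have le: "norm (c k * W k) \<le> q k" for k
  proof -
    have "(\<lambda>m. a m * b (k - m)) summable_on UNIV"
    proof (rule has_sum_convolution(1))
      show "(a has_sum infsum a UNIV) UNIV" "(b has_sum infsum b UNIV) UNIV"
        by (rule has_sum_infsum[OF Infinite_Sum.abs_summable_summable[OF a]]
          has_sum_infsum[OF Infinite_Sum.abs_summable_summable[OF b]])+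
    qed (rule a b)+
    then have "((\<lambda>m. a m * b (k - m) * W k) has_sum c k * W k) UNIV"
      unfolding c_def by (intro has_sum_cmult_left has_sum_infsum)
    moreover have "((\<lambda>m. norm (coord z m) * norm (coord w (k - m))) has_sum q k) UNIV"
      unfolding q_def by (rule has_sum_infsum[OF q(1)])
    ultimately show ?thesis
    proof (rule norm_infsum_le)
      fix m
      have "W k \<le> W m * W (k - m)"
        using W_add_le[of m "k - m"] by simp
      then have "norm (a m * b (k - m)) * W k \<le> norm (a m * b (k - m)) * (W m * W (k - m))"
        by (rule mult_left_mono) simp
      also have "\<dots> = norm (coord z m) * norm (coord w (k - m))"
        using W_pos[of m] W_pos[of "k - m"] by (simp add: a_def b_def norm_mult norm_divide)
      finally show "norm (a m * b (k - m) * W k) \<le> norm (coord z m) * norm (coord w (k - m))"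
        using W_pos[of k] by (simp add: norm_mult)
    qed
  qed
  have q_nonneg: "q k \<ge> 0" for k
    using le[of k] norm_ge_zero order_trans by blast
  have "(\<Sum>k\<in>F. norm (c k * W k)) \<le> norm z * norm w" if "finite F" for F
  proof -
    have "(\<Sum>k\<in>F. norm (c k * W k)) \<le> (\<Sum>k\<in>F. q k)"
      by (intro sum_mono le)
    also have "\<dots> \<le> norm z * norm w"
      by (rule finite_sum_le_has_sum[OF q(2)]) (use that q_nonneg in auto)
    finally show ?thesis .
  qed
  then obtain y where y: "coord y = (\<lambda>k. c k * W k)" "norm y \<le> norm z * norm w"
    by (rule l1_of_bounded_sums[of "\<lambda>k. c k * W k"]) auto
  have "synth y = (\<lambda>x. synth z x * synth w x)"
    using c_sum by (rule synth_eqI) (simp add: y)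
  with y(2) show ?thesis by blast
qed

text \<open>Conjugation reflects the lattice, and the weight depends on the length alone, so the
  reflected conjugate family keeps its norm.\<close>

lemma synth_cnj_ex: "\<exists>y. synth y = (\<lambda>x. cnj (synth z x)) \<and> norm y \<le> norm z"
proof -
  have W_minus: "W (- n) = W n" for n
    by (simp add: lattice_vec_minus)
  have hz: "((\<lambda>n. norm (cnj (coord z (- n)))) has_sum norm z) UNIV"
    using has_sum_infsum[OF coord_abs_summable[of z]]
    by (subst has_sum_reindex_bij_witness[of _ uminus uminus UNIV "\<lambda>n. norm (coord z n)"])
      (auto simp: norm_l1_eq)
  then have c: "coord (Abs_l1 (\<lambda>n. cnj (coord z (- n)))) = (\<lambda>n. cnj (coord z (- n)))"
    by (intro coord_Abs_l1) (rule has_sum_imp_summable)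
  have "((\<lambda>n. cnj (coord z (- n) / W n) * cis (\<theta> n * x)) has_sum cnj (synth z x)) UNIV" for x
  proof -
    have "((\<lambda>n. cnj (coord z n / W n * cis (\<theta> n * x))) has_sum cnj (synth z x)) UNIV"
      by (simp only: has_sum_cnj_iff synth_has_sum)
    then show ?thesis
      by (subst has_sum_reindex_bij_witness[of _ uminus uminus UNIV "\<lambda>n. cnj (coord z n / W n * cis (\<theta> n * x))"])
        (auto simp: lattice_vec_minus cis_cnj)
  qed
  then have "synth (Abs_l1 (\<lambda>n. cnj (coord z (- n)))) = (\<lambda>x. cnj (synth z x))"
    by (rule synth_eqI) (use W_pos in \<open>simp add: c less_imp_neq[THEN not_sym]\<close>)
  moreover have "norm (Abs_l1 (\<lambda>n. cnj (coord z (- n)))) \<le> norm z"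
    using hz by (simp add: norm_l1_eq[of "Abs_l1 _"] c infsumI)
  ultimately show ?thesis by blast
qed

text \<open>Defined through functions instead of convolutions: algebraic identities then hold
  pointwise and lift by injectivity of \<open>synth\<close>. \<open>coeffs\<close> is legitimate as
  the product lies in the range of \<open>synth\<close>.\<close>

definition pmult :: "(int ^ 'n) l1 \<Rightarrow> (int ^ 'n) l1 \<Rightarrow> (int ^ 'n) l1" where
  "pmult z w = coeffs (\<lambda>x. synth z x * synth w x)"

definition pcnj :: "(int ^ 'n) l1 \<Rightarrow> (int ^ 'n) l1" where
  "pcnj z = coeffs (\<lambda>x. cnj (synth z x))"

lemma synth_pmult: "synth (pmult z w) x = synth z x * synth w x"
  using synth_mult_ex[of z w] unfolding pmult_def by (metis coeffs_synth)

lemma norm_pmult_le: "norm (pmult z w) \<le> norm z * norm w"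
  using synth_mult_ex[of z w] unfolding pmult_def by (metis coeffs_synth)

lemma synth_pcnj: "synth (pcnj z) x = cnj (synth z x)"
  using synth_cnj_ex[of z] unfolding pcnj_def by (metis coeffs_synth)

lemma norm_pcnj_le: "norm (pcnj z) \<le> norm z"
  using synth_cnj_ex[of z] unfolding pcnj_def by (metis coeffs_synth)

lemma pmult_diff_left: "pmult (z - z') w = pmult z w - pmult z' w"
  by (simp add: synth_inject[symmetric] fun_eq_iff synth_pmult synth_diff left_diff_distrib)

lemma pmult_diff_right: "pmult z (w - w') = pmult z w - pmult z w'"
  by (simp add: synth_inject[symmetric] fun_eq_iff synth_pmult synth_diff right_diff_distrib)

lemma pcnj_diff: "pcnj (z - w) = pcnj z - pcnj w"
  by (simp add: synth_inject[symmetric] fun_eq_iff synth_pcnj synth_diff)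

lemma locally_lipschitz_pmult:
  assumes "locally_lipschitz F" "locally_lipschitz H"
  shows "locally_lipschitz (\<lambda>z. pmult (F z) (H z))"
  unfolding locally_lipschitz_def
proof
  fix R
  obtain K B where K: "K \<ge> 0" "B \<ge> 0" "\<And>x. norm x \<le> R \<Longrightarrow> norm (F x) \<le> B"
    "\<And>x y. norm x \<le> R \<Longrightarrow> norm y \<le> R \<Longrightarrow> norm (F x - F y) \<le> K * norm (x - y)"
    using locally_lipschitzE[OF assms(1), of R] by blast
  obtain L D where L: "L \<ge> 0" "D \<ge> 0" "\<And>x. norm x \<le> R \<Longrightarrow> norm (H x) \<le> D"
    "\<And>x y. norm x \<le> R \<Longrightarrow> norm y \<le> R \<Longrightarrow> norm (H x - H y) \<le> L * norm (x - y)"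
    using locally_lipschitzE[OF assms(2), of R] by blast
  have "norm (pmult (F x) (H x) - pmult (F y) (H y)) \<le> (K * D + B * L) * norm (x - y)"
    if xy: "norm x \<le> R" "norm y \<le> R" for x y
  proof -
    have eq: "pmult (F x) (H x) - pmult (F y) (H y) = pmult (F x - F y) (H x) + pmult (F y) (H x - H y)"
      by (simp add: pmult_diff_left pmult_diff_right)
    have "norm (pmult (F x) (H x) - pmult (F y) (H y))
        \<le> norm (F x - F y) * norm (H x) + norm (F y) * norm (H x - H y)"
      unfolding eq by (rule order_trans[OF norm_triangle_ineq]) (intro add_mono norm_pmult_le)
    also have "\<dots> \<le> (K * norm (x - y)) * D + B * (L * norm (x - y))"
      using xy K L by (intro add_mono mult_mono) auto
    finally show ?thesis by (simp add: algebra_simps)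
  qed
  then show "\<exists>K. \<forall>x y. norm x \<le> R \<longrightarrow> norm y \<le> R \<longrightarrow>
      norm (pmult (F x) (H x) - pmult (F y) (H y)) \<le> K * norm (x - y)"
    by blast
qed

text \<open>The power is unfolded into \<open>p\<close> multiplications by \<open>z\<close> times
  its conjugate, so that no absolute value remains.\<close>

primrec nonlin :: "nat \<Rightarrow> (int ^ 'n) l1 \<Rightarrow> (int ^ 'n) l1" where
  "nonlin 0 z = z"
| "nonlin (Suc p) z = pmult (nonlin p z) (pmult z (pcnj z))"

lemma nonlinearity_synth: "nonlinearity p (synth z) = synth (nonlin p z)"
proof
  fix x
  show "nonlinearity p (synth z) x = synth (nonlin p z) x"
  proof (induction p)
    case (Suc p)
    have *: "complex_of_real (cmod (synth z x) ^ (2 * Suc p))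
        = complex_of_real (cmod (synth z x) ^ (2 * p)) * (synth z x * cnj (synth z x))"
      by (simp add: power2_eq_square flip: complex_norm_square)
    show ?case
      unfolding nonlinearity_def nonlin.simps synth_pmult synth_pcnj *
        Suc[unfolded nonlinearity_def, symmetric]
      by (simp only: mult_ac)
  qed (simp add: nonlinearity_def)
qed

lemma locally_lipschitz_nonlin: "locally_lipschitz (nonlin p)"
proof (induction p)
  have id: "locally_lipschitz (\<lambda>z :: (int ^ 'n) l1. z)"
    unfolding locally_lipschitz_def by (metis mult_1 order_refl)
  {
    case 0
    show ?case using id by (simp add: nonlin.simps(1)[abs_def])
  next
    case (Suc p)
    have "locally_lipschitz pcnj"
      unfolding locally_lipschitz_def by (metis mult_1 norm_pcnj_le pcnj_diff)
    with id Suc show ?case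
      unfolding nonlin.simps(2)[abs_def] by (intro locally_lipschitz_pmult)
  }
qed

lemma nonlin_0: "p \<ge> 1 \<Longrightarrow> nonlin p 0 = 0"
  by (cases p) (simp_all add: synth_inject[symmetric] fun_eq_iff synth_pmult synth_0)

end

section \<open>The nonlinear Schroedinger equation\<close>

locale nls = fourier_weight \<omega> wt
  for \<omega> :: "real ^ 'n::finite" and wt :: "real \<Rightarrow> real" +
  fixes p :: nat and \<sigma> :: real
  assumes p_ge_1: "p \<ge> 1" and sign: "\<sigma> = 1 \<or> \<sigma> = -1"
begin

abbreviation S :: "real \<Rightarrow> (int ^ 'n) l1 \<Rightarrow> (int ^ 'n) l1" where
  "S \<equiv> schroedinger_group \<theta>"

text \<open>The factor in front of Duhamel's integral, of modulus 1, is absorbed here;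
  \<open>duhamel\<close> thus carries a plus sign for both choices of
  \<open>\<sigma>\<close>.\<close>

definition G :: "(int ^ 'n) l1 \<Rightarrow> (int ^ 'n) l1" where
  "G z = multiplier (\<lambda>_. - (of_real \<sigma> * \<i>)) (nonlin p z)"

lemma norm_coupling: "norm (- (complex_of_real \<sigma> * \<i>)) = 1"
  using sign by auto

sublocale semilinear S G
proof
  show "S t (x - y) = S t x - S t y" for t x y
    unfolding schroedinger_group_def by (rule multiplier_diff) simp
  show "norm (S t x) \<le> norm x" for t x
    unfolding schroedinger_group_def by (rule norm_multiplier_le) simp
  show "continuous_on UNIV (\<lambda>(t, x). S t x)"
    by (rule continuous_schroedinger_group)
  show "\<exists>K. \<forall>x y. norm x \<le> R \<longrightarrow> norm y \<le> R \<longrightarrow> norm (G x - G y) \<le> K * norm (x - y)" for R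
  proof -
    have "norm (G x - G y) \<le> norm (nonlin p x - nonlin p y)" for x y
      unfolding G_def using norm_coupling
      by (subst multiplier_diff[symmetric]) (simp_all add: norm_multiplier_le)
    then show ?thesis
      using locally_lipschitz_nonlin[of p] unfolding locally_lipschitz_def
      by (meson order_trans)
  qed
  show "G 0 = 0"
    unfolding G_def nonlin_0[OF p_ge_1]
    by (rule l1_eqI) (use norm_coupling in \<open>simp add: coord_multiplier\<close>)
qed

lemma synth_S_G: "synth (S t (G z)) x = - (of_real \<sigma> * \<i>) * synth (S t (nonlin p z)) x"
proof -
  have "S t (G z) = multiplier (\<lambda>_. - (of_real \<sigma> * \<i>)) (S t (nonlin p z))"
    using norm_coupling
    by (intro l1_eqI) (simp add: G_def coord_schroedinger_group coord_multiplier)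
  then show ?thesis
    using norm_coupling by (simp add: synth_mult_const)
qed

text \<open>The scalar Lebesgue integral of the solution concept meets the Banach-valued integral of
  \<open>duhamel\<close>: both reduce to the continuous function \<open>H\<close>, integrated once
  over time and once over time scaled to the unit interval.\<close>

lemma synth_duhamel:
  assumes f: "continuous_on {-T..T} f" and t: "t \<in> {-T..T}"
    and u: "\<And>\<tau>. \<tau> \<in> {-T..T} \<Longrightarrow> u \<tau> = synth (f \<tau>)"
  shows "synth (duhamel f t) x = - (of_real \<sigma> * \<i>)
    * (LBINT \<tau>=ereal 0..ereal t. propagator \<omega> (t - \<tau>) (nonlinearity p (u \<tau>)) x)"
proof -
  let ?\<kappa> = "- (complex_of_real \<sigma> * \<i>)"
  define H where "H \<tau> = synth (S (t - \<tau>) (G (f \<tau>))) x" for \<tau>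
  have H_cont: "continuous_on {-T..T} H"
    unfolding H_def
    by (intro bounded_linear.continuous_on[OF synth_bounded_linear] integrand_continuous)
      (use f in \<open>auto intro!: continuous_intros\<close>)
  \<comment> \<open>The substitution rule asks for continuity on the image of the unit interval,
    which runs from 0 to \<open>t\<close> for either sign of \<open>t\<close>.\<close>
  have H_cont': "continuous_on ((*) t ` {0..1}) H"
    by (rule continuous_on_subset[OF H_cont]) (use scaled_mem[OF t] in auto)
  have Ht_cont: "continuous_on {0..1} (\<lambda>s. t *\<^sub>R H (t * s))"
    by (intro continuous_intros continuous_on_compose2[OF H_cont'])  auto
  have int: "(\<lambda>s. S (t - t * s) (G (f (t * s)))) integrable_on {0..1}"
    by (intro integrable_continuous_interval integrand_continuous_s[OF f t])
  have "?\<kappa> * (LBINT \<tau>=ereal 0..ereal t. propagator \<omega> (t - \<tau>) (nonlinearity p (u \<tau>)) x)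
      = (LBINT \<tau>=ereal 0..ereal t. ?\<kappa> * propagator \<omega> (t - \<tau>) (nonlinearity p (u \<tau>)) x)"
    unfolding mult.assoc by (rule interval_lebesgue_integral_mult_right[symmetric])
  also have "\<dots> = (LBINT \<tau>=ereal 0..ereal t. H \<tau>)"
  proof (rule interval_integral_cong)
    \<comment> \<open>The hypothesis on \<open>u\<close> speaks of times between \<open>-T\<close>
      and \<open>T\<close>; all times between 0 and \<open>t\<close> are among them.\<close>
    fix \<tau> assume "\<tau> \<in> einterval (min (ereal 0) (ereal t)) (max (ereal 0) (ereal t))"
    then have "\<tau> \<in> {-T..T}"
      using t by (auto simp: einterval_def min_def max_def split: if_splits)
    then show "?\<kappa> * propagator \<omega> (t - \<tau>) (nonlinearity p (u \<tau>)) x = H \<tau>"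
      by (simp only: H_def u nonlinearity_synth propagator_synth synth_S_G)
  qed
  also have "\<dots> = (LBINT s=ereal 0..ereal 1. t *\<^sub>R H (t * s))"
    using interval_integral_substitution_finite[of 0 1 "\<lambda>s. t * s" "\<lambda>_. t" H] H_cont'
    by (auto intro!: derivative_eq_intros)
  also have "\<dots> = integral {0..1} (\<lambda>s. t *\<^sub>R H (t * s))"
    by (intro interval_integral_eq_integral borel_integrable_atLeastAtMost' Ht_cont) simp
  also have "\<dots> = t *\<^sub>R integral {0..1} (\<lambda>s. H (t * s))"
    by simp
  also have "integral {0..1} (\<lambda>s. H (t * s)) = synth (integral {0..1} (\<lambda>s. S (t - t * s) (G (f (t * s))))) x"
    using integral_linear[OF int synth_bounded_linear] by (simp add: H_def o_def)
  finally show ?thesis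
    by (simp add: duhamel_def synth_scaleR)
qed

section \<open>Transfer between solutions and their coefficient curves\<close>

lemma CA_space_imp_continuous_coeffs:
  assumes u: "u \<in> CA_space \<omega> wt T"
  shows "continuous_on {-T..T} (\<lambda>t. coeffs (u t))"
  unfolding continuous_on_def
proof
  fix t assume t: "t \<in> {-T..T}"
  have s: "synth (coeffs (u r)) = u r" if "r \<in> {-T..T}" for r
    using u that by (intro synth_coeffs) (auto simp: CA_space_def)
  have "((\<lambda>r. A_norm \<omega> wt (u r - u t)) \<longlongrightarrow> 0) (at t within {-T..T})"
    using u t by (simp add: CA_space_def)
  moreover have "A_norm \<omega> wt (u r - u t) = norm (coeffs (u r) - coeffs (u t))" if "r \<in> {-T..T}" for r
    using s[OF that] s[OF t] by (metis A_norm_synth synth_diff)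
  then have "eventually (\<lambda>r. A_norm \<omega> wt (u r - u t) = norm (coeffs (u r) - coeffs (u t))) (at t within {-T..T})"
    by (auto simp: eventually_at_filter)
  ultimately have "((\<lambda>r. norm (coeffs (u r) - coeffs (u t))) \<longlongrightarrow> 0) (at t within {-T..T})"
    by (rule Lim_transform_eventually)
  then show "((\<lambda>r. coeffs (u r)) \<longlongrightarrow> coeffs (u t)) (at t within {-T..T})"
    by (rule LIM_zero_cancel[OF tendsto_norm_zero_cancel])
qed

lemma restrict_synth_in_CA_space:
  assumes f: "continuous_on {-T..T} f"
  shows "restrict (\<lambda>t. synth (f t)) {-T..T} \<in> CA_space \<omega> wt T"
proof -
  let ?u = "restrict (\<lambda>t. synth (f t)) {-T..T}"
  have "((\<lambda>r. A_norm \<omega> wt (?u r - ?u t)) \<longlongrightarrow> 0) (at t within {-T..T})" if t: "t \<in> {-T..T}" for t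
  proof (rule Lim_transform_eventually)
    show "((\<lambda>r. norm (f r - f t)) \<longlongrightarrow> 0) (at t within {-T..T})"
      using f t by (intro tendsto_norm_zero LIM_zero) (auto simp: continuous_on_def)
    have "norm (f r - f t) = A_norm \<omega> wt (?u r - ?u t)" if "r \<in> {-T..T}" for r
      using t that by (simp add: A_norm_synth flip: synth_diff)
    then show "eventually (\<lambda>r. norm (f r - f t) = A_norm \<omega> wt (?u r - ?u t)) (at t within {-T..T})"
      by (auto simp: eventually_at_filter)
  qed
  then show ?thesis
    by (auto simp: CA_space_def A_space_eq)
qed

text \<open>Injectivity of \<open>synth\<close> lifts the identity at every point \<open>x\<close>
  to an identity in \<open>l1\<close>.\<close>

lemma NLS_solution_iff_mild_sol:
  assumes f: "continuous_on {-T..T} f" and u: "u = restrict (\<lambda>t. synth (f t)) {-T..T}"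
  shows "NLS_solution \<omega> wt p \<sigma> T (synth z) u \<longleftrightarrow> mild_sol T z f"
proof -
  have "(\<forall>x. u t x = propagator \<omega> t (synth z) x - complex_of_real \<sigma> * \<i>
        * (LBINT \<tau>=ereal 0..ereal t. propagator \<omega> (t - \<tau>) (nonlinearity p (u \<tau>)) x))
      \<longleftrightarrow> f t = S t z + duhamel f t" if t: "t \<in> {-T..T}" for t
  proof -
    have "f t = S t z + duhamel f t \<longleftrightarrow> (\<forall>x. synth (f t) x = synth (S t z) x + synth (duhamel f t) x)"
      by (simp add: synth_inject[symmetric] fun_eq_iff synth_add)
    moreover have "synth (duhamel f t) x = - (of_real \<sigma> * \<i>)
        * (LBINT \<tau>=ereal 0..ereal t. propagator \<omega> (t - \<tau>) (nonlinearity p (u \<tau>)) x)" for x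
      by (rule synth_duhamel[OF f t]) (simp add: u)
    moreover have "u t = synth (f t)"
      using t by (simp add: u)
    ultimately show ?thesis
      by (simp add: propagator_synth)
  qed
  then show ?thesis
    using restrict_synth_in_CA_space[OF f] f by (simp add: NLS_solution_def mild_sol_def u)
qed

lemma NLS_solution_imp_mild_sol:
  assumes "NLS_solution \<omega> wt p \<sigma> T (synth z) u"
  shows "mild_sol T z (\<lambda>t. coeffs (u t))" "u = restrict (\<lambda>t. synth (coeffs (u t))) {-T..T}"
proof -
  have CA: "u \<in> CA_space \<omega> wt T"
    using assms by (simp add: NLS_solution_def)
  show u: "u = restrict (\<lambda>t. synth (coeffs (u t))) {-T..T}"
  proof
    show "u t = restrict (\<lambda>t. synth (coeffs (u t))) {-T..T} t" for t
      using CA by (cases "t \<in> {-T..T}") (auto simp: CA_space_def intro: synth_coeffs[symmetric])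
  qed
  show "mild_sol T z (\<lambda>t. coeffs (u t))"
    using NLS_solution_iff_mild_sol[OF CA_space_imp_continuous_coeffs[OF CA] u] assms by blast
qed

lemma mild_sol_imp_NLS_solution:
  assumes "mild_sol T z f"
  shows "NLS_solution \<omega> wt p \<sigma> T (synth z) (restrict (\<lambda>t. synth (f t)) {-T..T})"
  using NLS_solution_iff_mild_sol[of T f] assms by (auto simp: mild_sol_def)

text \<open>Coefficients are compared at times in the interval; at all other times both functions
  are \<open>undefined\<close>, which yields equality in HOL.\<close>

lemma NLS_solution_unique:
  assumes "NLS_solution \<omega> wt p \<sigma> T (synth z) u" "NLS_solution \<omega> wt p \<sigma> T (synth z) v"
  shows "u = v"
proof -
  have "coeffs (u t) = coeffs (v t)" if "t \<in> {-T..T}" for t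
    by (rule mild_sol_unique[OF NLS_solution_imp_mild_sol(1)[OF assms(1)]
          NLS_solution_imp_mild_sol(1)[OF assms(2)] that])
  then have "restrict (\<lambda>t. synth (coeffs (u t))) {-T..T} = restrict (\<lambda>t. synth (coeffs (v t))) {-T..T}"
    by (intro restrict_ext) simp
  then show ?thesis
    using NLS_solution_imp_mild_sol(2)[OF assms(1)] NLS_solution_imp_mild_sol(2)[OF assms(2)] by simp
qed

lemma data_to_solution_eq:
  assumes "mild_sol T z f" "t \<in> {-T..T}"
  shows "data_to_solution \<omega> wt p \<sigma> T (synth z) t = synth (f t)"
proof -
  have "data_to_solution \<omega> wt p \<sigma> T (synth z) = restrict (\<lambda>t. synth (f t)) {-T..T}"
    unfolding data_to_solution_def
    using mild_sol_imp_NLS_solution[OF assms(1)] NLS_solution_unique by (intro the_equality)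
  then show ?thesis using assms(2) by simp
qed

end

theorem theorem4p1:
  fixes \<omega> :: "real ^ 'n::finite" and p :: nat and wt :: "real \<Rightarrow> real" and \<sigma> :: real
  assumes "p \<ge> 1"
    and "entries_int_independent \<omega>"
    and "\<forall>q\<ge>0. wt q > 0"
    and "mono_on {0..} wt"
    and "\<exists>c>0. \<forall>q\<ge>0. c \<le> wt q"
    and "\<forall>q\<ge>0. \<forall>r\<ge>0. wt (q + r) \<le> wt q * wt r"
    and "\<sigma> = 1 \<or> \<sigma> = -1"
  shows "\<forall>u0 \<in> A_space \<omega> wt. \<exists>a \<in> A_space \<omega> wt. \<exists>r>0. \<exists>T>0.
           u0 \<in> A_ball \<omega> wt a r \<and>
           (\<forall>v \<in> A_ball \<omega> wt a r. \<exists>!u. NLS_solution \<omega> wt p \<sigma> T v u) \<and>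
           (\<exists>L\<ge>0. \<forall>v \<in> A_ball \<omega> wt a r. \<forall>w \<in> A_ball \<omega> wt a r.
              CA_norm \<omega> wt T (data_to_solution \<omega> wt p \<sigma> T v - data_to_solution \<omega> wt p \<sigma> T w)
                \<le> L * A_norm \<omega> wt (v - w))"
proof
  interpret nls \<omega> wt p \<sigma>
    using assms by unfold_locales auto
  fix u0
  assume u0: "u0 \<in> A_space \<omega> wt"
  then obtain z0 where z0: "u0 = synth z0"
    by (auto simp: A_space_eq)
  \<comment> \<open>The ball of data will have centre \<open>u0\<close> and radius 1, so
    \<open>norm z0 + 1\<close> bounds all its members and fixes \<open>T\<close> before a datum is
    chosen.\<close>
  obtain T where T: "T > 0"
    "\<And>z. norm z \<le> norm z0 + 1 \<Longrightarrow> \<exists>f. mild_sol T z f"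
    "\<And>z w f g t. norm z \<le> norm z0 + 1 \<Longrightarrow> norm w \<le> norm z0 + 1 \<Longrightarrow> mild_sol T z f \<Longrightarrow> mild_sol T w g
      \<Longrightarrow> t \<in> {-T..T} \<Longrightarrow> norm (f t - g t) \<le> 2 * norm (z - w)"
    using mild_well_posed[of "norm z0 + 1"] by (metis add_nonneg_nonneg norm_ge_zero zero_le_one)
  have ball: "\<exists>z. v = synth z \<and> norm z \<le> norm z0 + 1" if v: "v \<in> A_ball \<omega> wt u0 1" for v
  proof -
    obtain z where z: "v = synth z" "A_norm \<omega> wt (v - u0) < 1"
      using v by (auto simp: A_ball_def A_space_eq)
    then have "norm (z - z0) < 1"
      by (simp add: z0 A_norm_synth flip: synth_diff)
    then have "norm z \<le> norm z0 + 1"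
      using norm_triangle_sub[of z z0] by simp
    with z(1) show ?thesis by blast
  qed
  show "\<exists>a \<in> A_space \<omega> wt. \<exists>r>0. \<exists>T>0.
           u0 \<in> A_ball \<omega> wt a r \<and>
           (\<forall>v \<in> A_ball \<omega> wt a r. \<exists>!u. NLS_solution \<omega> wt p \<sigma> T v u) \<and>
           (\<exists>L\<ge>0. \<forall>v \<in> A_ball \<omega> wt a r. \<forall>w \<in> A_ball \<omega> wt a r.
              CA_norm \<omega> wt T (data_to_solution \<omega> wt p \<sigma> T v - data_to_solution \<omega> wt p \<sigma> T w)
                \<le> L * A_norm \<omega> wt (v - w))"
  proof (rule bexI[OF _ u0], rule exI[of _ 1], rule conjI[OF zero_less_one], rule exI[of _ T],
      intro conjI ballI, rule T(1), goal_cases)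
    case 1
    show "u0 \<in> A_ball \<omega> wt u0 1"
      using u0 by (simp add: A_ball_def z0 A_norm_synth flip: synth_diff)
  next
    case (2 v)
    show "\<exists>!u. NLS_solution \<omega> wt p \<sigma> T v u"
      using ball[OF 2] T(2) mild_sol_imp_NLS_solution NLS_solution_unique by metis
  next
    case 3
    have "CA_norm \<omega> wt T (data_to_solution \<omega> wt p \<sigma> T v - data_to_solution \<omega> wt p \<sigma> T w)
        \<le> 2 * A_norm \<omega> wt (v - w)"
      if vw: "v \<in> A_ball \<omega> wt u0 1" "w \<in> A_ball \<omega> wt u0 1" for v w
    proof -
      obtain z y where z: "v = synth z" "norm z \<le> norm z0 + 1" and y: "w = synth y" "norm y \<le> norm z0 + 1"
        using ball[OF vw(1)] ball[OF vw(2)] by blast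
      obtain f g where f: "mild_sol T z f" and g: "mild_sol T y g"
        using T(2)[OF z(2)] T(2)[OF y(2)] by blast
      show ?thesis
        unfolding CA_norm_def
      \<comment> \<open>A bound at each time suffices, given a nonempty index set;
        \<open>T > 0\<close> ensures the latter.\<close>
      proof (rule cSUP_least)
        fix t assume t: "t \<in> {-T..T}"
        show "A_norm \<omega> wt ((data_to_solution \<omega> wt p \<sigma> T v - data_to_solution \<omega> wt p \<sigma> T w) t)
            \<le> 2 * A_norm \<omega> wt (v - w)"
          using T(3)[OF z(2) y(2) f g t]
          by (simp add: z(1) y(1) data_to_solution_eq[OF f t] data_to_solution_eq[OF g t] A_norm_synth
              flip: synth_diff)
      qed (use T(1) in simp)
    qed
    then show ?case
      by (intro exI[of _ 2]) simp
  qed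
qed

end
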